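(* Assume $\mathbf J$ is positive definite (so that $g$ is convex) and that every global maximum point of $f$ has a homogeneous type. Let $k^*$ be the largest homogeneous type among the global maximum points of $f$, and let $\mu^1,\dots,\mu^P$ be the global maximum points of homogeneous type $k^*$. Then, as $N\to\infty$ (with $\alpha$ fixed), the law under $P_N$ of the random vector $(m_1(\sigma),\dots,m_n(\sigma))$ converges weakly to $$\frac{\sum_{p=1}^P b_p\,\delta_{\mu^p}}{\sum_{p=1}^Pb_p},\qquad b_p=\int_{\mathbb{R}^n}\exp\Big(f^{\mu^p}_{2k^*}\Big(\frac{x}{\alpha^{1/(2k^* )}}\Big)\Big)\,dx,$$ where $\delta_{\mu^p}$ is the unit point mass at $\mu^p$.
   Context: Fix $n\ge1$, weights $\alpha_1,\dots,\alpha_n\in(0,1)$ with $\sum_l\alpha_l=1$, a real symmetric $n\times n$ matrix $\mathbf J=(J_{ls})$ with $J_{ll}>0$ (the reduced interaction matrix), and $\mathbf h\in\mathbb{R}^n$. For each $N$, $\{1,\dots,N\}$ is partitioned into disjoint sets $P_1,\dots,P_n$ with $|P_l|=N_l=\alpha_lN$ (the $\alpha_l$ held fixed as $N\to\infty$). For $\sigma\in\Omega_N=\{-1,1\}^N$ let $S_l(\sigma)=\sum_{i\in P_l}\sigma_i$, $m_l(\sigma)=S_l(\sigma)/N_l$, and $H_N(\sigma)=-Ng(m_1(\sigma),\dots,m_n(\sigma))$ with $g(x)=\frac12\sum_{l,s}\alpha_l\alpha_sJ_{ls}x_lx_s+\sum_l\alpha_lh_lx_l$. The Gibbs measure is $P_N(\sigma)=\exp(-H_N(\sigma))/\sum_{\tau\in\Omega_N}\exp(-H_N(\tau))$.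 Define $f(x)=-\frac12\sum_{l,s=1}^n\alpha_l\alpha_sJ_{ls}x_lx_s+\sum_{l=1}^n\alpha_l\ln\cosh\big(\sum_{s=1}^n\alpha_sJ_{ls}x_s+h_l\big)$ on $\mathbb{R}^n$. Homogeneous type: for a global maximum point $\mu$ of $f$, write the Taylor expansion $f(\mu+y)=f(\mu)+\sum_{j\ge1}T_j(y)$ with $T_j$ homogeneous polynomials of degree $j$; $\mu$ has homogeneous type $k$ (a positive integer) if $T_j\equiv0$ for $1\le j\le 2k-1$ and $T_{2k}(y)<0$ for all $y\neq0$; then set $f^{\mu}_{2k}=T_{2k}$. Vector notation: for $x\in\mathbb{R}^n$ and $\gamma\in\mathbb{R}$, $x/\alpha^{\gamma}=(x_1/\alpha_1^{\gamma},\dots,x_n/\alpha_n^{\gamma})$. *)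

theory Defs
  imports "HOL-Analysis.Analysis" "HOL-Probability.Probability"
begin

text \<open>Index set of the n blocks: a finite type 'n (so n = CARD('n) \<ge> 1).
  Vectors of R^n are elements of real^'n.\<close>

definition g_fun :: "('n::finite \<Rightarrow> real) \<Rightarrow> ('n \<Rightarrow> 'n \<Rightarrow> real) \<Rightarrow> ('n \<Rightarrow> real)
    \<Rightarrow> real^'n \<Rightarrow> real" where
  "g_fun \<alpha> J h x =
     (1/2) * (\<Sum>l\<in>UNIV. \<Sum>s\<in>UNIV. \<alpha> l * \<alpha> s * J l s * x$l * x$s)
     + (\<Sum>l\<in>UNIV. \<alpha> l * h l * x$l)"

definition f_fun :: "('n::finite \<Rightarrow> real) \<Rightarrow> ('n \<Rightarrow> 'n \<Rightarrow> real) \<Rightarrow> ('n \<Rightarrow> real)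
    \<Rightarrow> real^'n \<Rightarrow> real" where
  "f_fun \<alpha> J h x =
     - (1/2) * (\<Sum>l\<in>UNIV. \<Sum>s\<in>UNIV. \<alpha> l * \<alpha> s * J l s * x$l * x$s)
     + (\<Sum>l\<in>UNIV. \<alpha> l * ln (cosh ((\<Sum>s\<in>UNIV. \<alpha> s * J l s * x$s) + h l)))"

definition taylor_term :: "(real^'n::finite \<Rightarrow> real) \<Rightarrow> real^'n \<Rightarrow> nat \<Rightarrow> real^'n \<Rightarrow> real" where
  "taylor_term F \<mu> j y = (deriv ^^ j) (\<lambda>t. F (\<mu> + t *\<^sub>R y)) 0 / fact j"

definition global_max_points :: "(real^'n::finite \<Rightarrow> real) \<Rightarrow> (real^'n) set" where
  "global_max_points F = {\<mu>. \<forall>x. F x \<le> F \<mu>}"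

definition has_hom_type :: "(real^'n::finite \<Rightarrow> real) \<Rightarrow> real^'n \<Rightarrow> nat \<Rightarrow> bool" where
  "has_hom_type F \<mu> k \<longleftrightarrow> k \<ge> 1
     \<and> (\<forall>j\<in>{1..2*k-1}. \<forall>y. taylor_term F \<mu> j y = 0)
     \<and> (\<forall>y. y \<noteq> 0 \<longrightarrow> taylor_term F \<mu> (2*k) y < 0)"

definition hom_type :: "(real^'n::finite \<Rightarrow> real) \<Rightarrow> real^'n \<Rightarrow> nat" where
  "hom_type F \<mu> = (THE k. has_hom_type F \<mu> k)"

definition max_hom_type :: "(real^'n::finite \<Rightarrow> real) \<Rightarrow> nat" where
  "max_hom_type F = Max (hom_type F ` global_max_points F)"

definition b_weight :: "('n::finite \<Rightarrow> real) \<Rightarrow> (real^'n \<Rightarrow> real) \<Rightarrow> nat \<Rightarrow> real^'n \<Rightarrow> real" where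
  "b_weight \<alpha> F k \<mu> =
     (\<integral>x. exp (taylor_term F \<mu> (2*k) (\<chi> l. x$l / (\<alpha> l powr (1 / real (2*k))))) \<partial>lborel)"

definition config_space :: "nat \<Rightarrow> (nat \<Rightarrow> real) set" where
  "config_space N = PiE {1..N} (\<lambda>_. {-1, 1})"

definition is_block_partition :: "('n::finite \<Rightarrow> real) \<Rightarrow> nat \<Rightarrow> ('n \<Rightarrow> nat set) \<Rightarrow> bool" where
  "is_block_partition \<alpha> N P \<longleftrightarrow>
     (\<Union>l. P l) = {1..N} \<and> (\<forall>l s. l \<noteq> s \<longrightarrow> P l \<inter> P s = {})
     \<and> (\<forall>l. real (card (P l)) = \<alpha> l * real N)"

definition magnetization :: "('n::finite \<Rightarrow> nat set) \<Rightarrow> (nat \<Rightarrow> real) \<Rightarrow> real^'n" where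
  "magnetization P \<sigma> = (\<chi> l. (\<Sum>i\<in>P l. \<sigma> i) / real (card (P l)))"

definition gibbs_pmf :: "('n::finite \<Rightarrow> real) \<Rightarrow> ('n \<Rightarrow> 'n \<Rightarrow> real) \<Rightarrow> ('n \<Rightarrow> real)
    \<Rightarrow> nat \<Rightarrow> ('n \<Rightarrow> nat set) \<Rightarrow> (nat \<Rightarrow> real) pmf" where
  "gibbs_pmf \<alpha> J h N P = embed_pmf (\<lambda>\<sigma>.
     if \<sigma> \<in> config_space N then
       exp (real N * g_fun \<alpha> J h (magnetization P \<sigma>))
       / (\<Sum>\<tau>\<in>config_space N. exp (real N * g_fun \<alpha> J h (magnetization P \<tau>)))
     else 0)"

definition magnetization_law :: "('n::finite \<Rightarrow> real) \<Rightarrow> ('n \<Rightarrow> 'n \<Rightarrow> real) \<Rightarrow> ('n \<Rightarrow> real)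
    \<Rightarrow> nat \<Rightarrow> ('n \<Rightarrow> nat set) \<Rightarrow> (real^'n) pmf" where
  "magnetization_law \<alpha> J h N P = map_pmf (magnetization P) (gibbs_pmf \<alpha> J h N P)"

definition weighted_dirac_mixture :: "'a set \<Rightarrow> ('a \<Rightarrow> real) \<Rightarrow> 'a pmf" where
  "weighted_dirac_mixture S w = embed_pmf (\<lambda>x. if x \<in> S then w x / (\<Sum>y\<in>S. w y) else 0)"

definition weak_conv_pmf :: "(nat \<Rightarrow> (real^'n::finite) pmf) \<Rightarrow> (real^'n) pmf \<Rightarrow> bool" where
  "weak_conv_pmf Q L \<longleftrightarrow>
     (\<forall>\<phi> :: real^'n \<Rightarrow> real. continuous_on UNIV \<phi> \<and> bounded (range \<phi>) \<longrightarrow>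
        (\<lambda>k. measure_pmf.expectation (Q k) \<phi>) \<longlonglongrightarrow> measure_pmf.expectation L \<phi>)"

end

theory Submission
  imports Defs "HOL-Computational_Algebra.Polynomial" "HOL-Real_Asymp.Real_Asymp"
begin

text \<open>Let M be the matrix with entries \<open>\<alpha> l * \<alpha> s * J l s\<close>, which is positive definite. Completing the
  square and summing over the spins (the Hubbard-Stratonovich transformation) shows that the law of the
  magnetization, convolved with the centred Gaussian law whose covariance is the inverse of N M, has a
  density proportional to \<open>exp (N * f x)\<close>. The Gaussian noise vanishes as N grows, so the limit of the law
  is that of these densities, which is found by Laplace's method: rescaling by \<open>N powr (1 / (2 * k))\<close>
  around a maximum point of type k gives a mass of order \<open>N powr (- n / (2 * k))\<close> with the constant
  \<open>\<integral>y. exp (T y) \<partial>lborel\<close>, where T is the Taylor polynomial of degree \<open>2 * k\<close>. Hence only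
  the maximum points of largest type survive. The integrand of \<open>b_weight\<close> differs from \<open>exp (T y)\<close> by a
  diagonal change of variables, whose Jacobian does not depend on the maximum point and cancels.\<close>

section \<open>Laplace's method\<close>

text \<open>Passing to the smoothed law avoids all asymptotics of binomial coefficients: for fixed x
  the completed square leaves an exponent linear in the spins, so the sum over configurations is
  evaluated exactly for every N. Positive definiteness enters twice. It makes the Gaussian noise
  integrable, and it makes f decay quadratically, since \<open>ln (cosh u)\<close> grows only
  linearly; the maximum points therefore form a compact set, and as a homogeneous type isolates each
  of them, they are finitely many.

  The delicate point is that the noise and the Gibbs law change with N together. The two limits are
  decoupled by writing the smoothed expectation as a ratio of two Laplace integrals, in which the
  prefactors depending on N cancel, and by estimating its distance from the true expectation
  uniformly over all configurations.\<close>

lemma lborel_integral_affine: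
  fixes f :: "'a::euclidean_space \<Rightarrow> real" and c :: real
  assumes [measurable]: "f \<in> borel_measurable borel" and c: "c \<noteq> 0"
  shows "(\<integral>x. f x \<partial>lborel) = \<bar>c\<bar> ^ DIM('a) * (\<integral>x. f (t + c *\<^sub>R x) \<partial>lborel)"
proof -
  have "(\<integral>x. f x \<partial>lborel)
      = (\<integral>x. f x \<partial>density (distr lborel borel (\<lambda>x. t + c *\<^sub>R x)) (\<lambda>_. ennreal (\<bar>c\<bar> ^ DIM('a))))"
    using lborel_affine[OF c, of t] by (simp add: ennreal_power)
  then show ?thesis
    by (simp add: integral_density integral_distr)
qed

lemma lborel_integral_diagonal:
  fixes f :: "real^'n::finite \<Rightarrow> real"
  assumes [measurable]: "f \<in> borel_measurable borel" and c: "\<And>l. c l > 0"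
  shows "(\<integral>x. f x \<partial>lborel) = (\<Prod>l\<in>UNIV. c l) * (\<integral>x. f (\<chi> l. c l * x $ l) \<partial>lborel)"
proof -
  \<comment> \<open>The change of variables for \<open>lborel\<close> takes its coefficients on
    basis vectors; \<open>d\<close> transports \<open>c\<close> along the bijection between indices
    and the vectors \<open>axis l 1\<close>.\<close>
  define d where "d = (\<lambda>b::real^'n. c (THE l. b = axis l 1))"
  have d: "d (axis l 1) = c l" for l
    by (simp add: d_def axis_eq_axis)
  have B: "(Basis :: (real^'n) set) = range (\<lambda>l. axis l 1)"
    by (auto simp: Basis_vec_def)
  have inj: "inj (\<lambda>l. axis l (1::real) :: real^'n)"
    by (auto simp: inj_def axis_eq_axis)
  have T: "(\<Sum>j\<in>Basis. (d j * (x \<bullet> j)) *\<^sub>R j) = (\<chi> l. c l * x $ l)" for x :: "real^'n"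
  proof -
    have "(\<Sum>j\<in>Basis. (d j * (x \<bullet> j)) *\<^sub>R j) = (\<Sum>l\<in>UNIV. (c l * x $ l) *\<^sub>R axis l 1)"
      unfolding B by (subst sum.reindex[OF inj]) (simp add: d inner_axis)
    then show ?thesis
      by (simp add: vec_eq_iff axis_def if_distrib cong: if_cong)
  qed
  have P: "(\<Prod>j\<in>Basis. \<bar>d j\<bar>) = (\<Prod>l\<in>UNIV. c l)"
    unfolding B by (subst prod.reindex[OF inj]) (simp add: d abs_of_pos c)
  have nz: "\<And>j. j \<in> (Basis :: (real^'n) set) \<Longrightarrow> d j \<noteq> 0"
    unfolding B using c d by (auto simp: less_imp_neq[symmetric])
  have [measurable]: "(\<lambda>x::real^'n. \<chi> l. c l * x $ l) \<in> borel_measurable borel"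
    by (intro borel_measurable_continuous_onI continuous_intros)
  have pos: "0 \<le> (\<Prod>l\<in>UNIV. c l)"
    using c by (intro prod_nonneg) (auto simp: less_imp_le)
  have L: "(lborel :: (real^'n) measure)
      = density (distr lborel borel (\<lambda>x. \<chi> l. c l * x $ l)) (\<lambda>_. ennreal (\<Prod>l\<in>UNIV. c l))"
    using lborel_affine_euclidean[of d 0, OF nz] by (simp add: T P)
  have "(\<integral>x. f x \<partial>lborel)
      = (\<integral>x. f x \<partial>density (distr lborel borel (\<lambda>x. \<chi> l. c l * x $ l)) (\<lambda>_. ennreal (\<Prod>l\<in>UNIV. c l)))"
    using L by simp
  then show ?thesis
    using pos by (simp add: integral_density integral_distr)
qed

text \<open>The squared norm is a sum over coordinates, so the Gaussian is a product of
  one-dimensional ones. Those are integrable by the known half-line moment, evenness and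
  scaling.\<close>

lemma integrable_gaussian:
  fixes c :: real
  assumes c: "c > 0"
  shows "integrable lborel (\<lambda>x::'a::euclidean_space. exp (- c * (norm x)\<^sup>2))"
proof -
  have i1: "integrable lborel (\<lambda>t::real. exp (- c * t\<^sup>2))"
  proof -
    have "has_bochner_integral lborel (\<lambda>t::real. indicator {0..} t *\<^sub>R exp (- t\<^sup>2)) (sqrt pi / 2)"
      by (rule gaussian_moment_0)
    from has_bochner_integral_even_function[OF this]
    have "integrable lborel (\<lambda>t::real. exp (- t\<^sup>2))"
      by (simp add: has_bochner_integral_iff)
    from lborel_integrable_real_affine[OF this, of "sqrt c" 0]
    show ?thesis using c by (simp add: power_mult_distrib)
  qed
  have nrm: "(norm (\<Sum>b\<in>Basis. f b *\<^sub>R b))\<^sup>2 = (\<Sum>b\<in>Basis. (f b)\<^sup>2)" for f :: "'a \<Rightarrow> real"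
    by (subst power2_norm_eq_inner, subst euclidean_inner) (simp add: power2_eq_square)
  interpret product_sigma_finite "\<lambda>_::'a. lborel :: real measure"
    by standard
  have "integrable (Pi\<^sub>M Basis (\<lambda>_::'a. lborel)) (\<lambda>f. \<Prod>b\<in>Basis. exp (- c * (f b)\<^sup>2))"
    by (rule product_integrable_prod) (use i1 in auto)
  also have "(\<lambda>f::'a\<Rightarrow>real. \<Prod>b\<in>Basis. exp (- c * (f b)\<^sup>2)) = 
      (\<lambda>f. exp (- c * (norm (\<Sum>b\<in>Basis. f b *\<^sub>R b))\<^sup>2))"
    by (simp add: fun_eq_iff nrm exp_sum[symmetric] sum_distrib_left sum_negf)
  finally show ?thesis
    by (subst lborel_eq) (subst integrable_distr_eq; simp)
qed

text \<open>Substituting \<open>\<mu> + s i *\<^sub>R y\<close> for the variable turns the integral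
  over a fixed ball into one over balls growing to the whole space. The rescaled integrand converges
  pointwise by \<open>lim\<close>, and \<open>bound\<close> is invariant under the rescaling, so it
  yields a dominating function that does not depend on i.\<close>

lemma laplace_local:
  fixes F \<phi> T :: "'a::euclidean_space \<Rightarrow> real" and s :: "nat \<Rightarrow> real"
  assumes [measurable]: "F \<in> borel_measurable borel" and \<phi>: "continuous_on UNIV \<phi>" "\<And>x. \<bar>\<phi> x\<bar> \<le> B"
    and k: "k \<ge> 1" and r: "r > 0" and c: "c > 0"
    and bound: "\<And>y. norm y \<le> r \<Longrightarrow> F (\<mu> + y) \<le> - c * norm y ^ (2*k)"
    and lim: "\<And>y. ((\<lambda>t. F (\<mu> + t *\<^sub>R y) / t ^ (2*k)) \<longlongrightarrow> T y) (at_right 0)"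
    and s: "\<And>i. s i > 0" "s \<longlonglongrightarrow> 0"
  shows "(\<lambda>i. (\<integral>x. indicator (cball \<mu> r) x * (\<phi> x * exp (F x / s i ^ (2*k))) \<partial>lborel) / s i ^ DIM('a))
            \<longlonglongrightarrow> \<phi> \<mu> * (\<integral>y. exp (T y) \<partial>lborel)" (is ?th1)
    and "integrable lborel (\<lambda>y. exp (T y))" (is ?th2)
proof -
  \<comment> \<open>Nothing is known about \<open>T\<close> except that it is a pointwise limit of
    rescaled copies of \<open>F\<close>, and this is enough for measurability.\<close>
  have Tm: "T \<in> borel_measurable borel"
  proof (rule borel_measurable_LIMSEQ_real)
    show "(\<lambda>i. F (\<mu> + s i *\<^sub>R y) / s i ^ (2*k)) \<longlonglongrightarrow> T y" for y
      by (rule filterlim_compose[OF lim[of y]])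
         (use s in \<open>auto simp: filterlim_at less_imp_neq[symmetric] intro!: always_eventually\<close>)
  qed measurable
  note [measurable] = Tm borel_measurable_continuous_onI[OF \<phi>(1)]
  \<comment> \<open>Since \<open>t\<^sup>2 - 1 \<le> t ^ (2*k)\<close> for \<open>t \<ge> 0\<close>
    and \<open>k \<ge> 1\<close>, a Gaussian with the extra factor \<open>exp c\<close> dominates
    for every order k at once.\<close>
  define W where "W = (\<lambda>y::'a. exp c * exp (- c * (norm y)\<^sup>2))"
  have W: "integrable lborel W"
    unfolding W_def using integrable_gaussian[OF c, where 'a='a] by simp
  have Wb: "exp (- c * norm y ^ (2*k)) \<le> W y" for y :: 'a
  proof -
    have "(norm y)\<^sup>2 - 1 \<le> norm y ^ (2*k)"
    proof (cases "norm y \<le> 1")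
      case True
      then have "(norm y)\<^sup>2 \<le> 1" by (simp add: power_le_one)
      then show ?thesis by (smt (verit) norm_ge_zero zero_le_power)
    next
      case False
      then have "norm y ^ 2 \<le> norm y ^ (2*k)" using k by (intro power_increasing) auto
      then show ?thesis by simp
    qed
    then have "c * ((norm y)\<^sup>2 - 1) \<le> c * norm y ^ (2*k)"
      using c by (intro mult_left_mono) auto
    then show ?thesis
      unfolding W_def exp_add[symmetric] by (simp add: algebra_simps)
  qed
  define G where "G = (\<lambda>i y. indicator (cball \<mu> r) (\<mu> + s i *\<^sub>R y) *
      (\<phi> (\<mu> + s i *\<^sub>R y) * exp (F (\<mu> + s i *\<^sub>R y) / s i ^ (2*k))) :: real)"
  have [measurable]: "cball \<mu> r \<in> sets borel"
    by simp
  have [measurable]: "(\<lambda>x. indicator (cball \<mu> r) x * (\<phi> x * exp (F x / a))) \<in> borel_measurable borel" for a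
    by measurable
  have eq: "(\<integral>x. indicator (cball \<mu> r) x * (\<phi> x * exp (F x / s i ^ (2*k))) \<partial>lborel) / s i ^ DIM('a)
      = (\<integral>y. G i y \<partial>lborel)" for i
    unfolding G_def using s(1)[of i]
    by (subst lborel_integral_affine[where c="s i" and t=\<mu>]) simp_all
  have ev: "\<forall>\<^sub>F i in sequentially. norm (s i *\<^sub>R y) \<le> r" for y :: 'a
  proof -
    have "(\<lambda>i. norm (s i *\<^sub>R y)) \<longlonglongrightarrow> norm (0 *\<^sub>R y)"
      by (intro tendsto_intros s)
    then show ?thesis
      using r by (intro eventually_mono[OF order_tendstoD(2)[where a=r]]) (auto simp: less_imp_le)
  qed
  have e: "exp (F (\<mu> + s i *\<^sub>R y) / s i ^ (2*k)) \<le> W y" if "norm (s i *\<^sub>R y) \<le> r" for i y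
  proof -
    have "F (\<mu> + s i *\<^sub>R y) / s i ^ (2*k) \<le> (- c * norm (s i *\<^sub>R y) ^ (2*k)) / s i ^ (2*k)"
      using bound[OF that] s(1)[of i] by (intro divide_right_mono) auto
    also have "\<dots> = - c * norm y ^ (2*k)"
      using s(1)[of i] by (simp add: power_mult_distrib)
    finally show ?thesis using Wb[of y] by (smt (verit) exp_le_cancel_iff)
  qed
  have B0: "B \<ge> 0" using \<phi>(2)[of 0] by linarith
  have limF: "(\<lambda>i. F (\<mu> + s i *\<^sub>R y) / s i ^ (2*k)) \<longlonglongrightarrow> T y" for y
    by (rule filterlim_compose[OF lim[of y]])
       (use s in \<open>auto simp: filterlim_at less_imp_neq[symmetric] intro!: always_eventually\<close>)
  have "(\<lambda>i. \<integral>y. G i y \<partial>lborel) \<longlonglongrightarrow> (\<integral>y. \<phi> \<mu> * exp (T y) \<partial>lborel)"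
  proof (rule integral_dominated_convergence[where w="\<lambda>y. B * W y"])
    show "G i \<in> borel_measurable lborel" for i
      unfolding G_def by measurable
    show "integrable lborel (\<lambda>y. B * W y)" using W by simp
    show "AE y in lborel. (\<lambda>i. G i y) \<longlonglongrightarrow> \<phi> \<mu> * exp (T y)"
    proof (rule AE_I2)
      fix y
      have "(\<lambda>i. \<phi> (\<mu> + s i *\<^sub>R y)) \<longlonglongrightarrow> \<phi> (\<mu> + 0 *\<^sub>R y)"
        by (rule continuous_on_tendsto_compose[OF \<phi>(1)]) (intro tendsto_intros s | simp)+
      then have "(\<lambda>i. \<phi> (\<mu> + s i *\<^sub>R y) * exp (F (\<mu> + s i *\<^sub>R y) / s i ^ (2*k))) \<longlonglongrightarrow> \<phi> \<mu> * exp (T y)"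
        by (intro tendsto_intros limF) simp
      moreover have "\<forall>\<^sub>F i in sequentially. \<phi> (\<mu> + s i *\<^sub>R y) * exp (F (\<mu> + s i *\<^sub>R y) / s i ^ (2*k)) = G i y"
        using ev[of y] by eventually_elim (auto simp: G_def dist_norm indicator_def)
      ultimately show "(\<lambda>i. G i y) \<longlonglongrightarrow> \<phi> \<mu> * exp (T y)"
        by (rule Lim_transform_eventually)
    qed
    show "AE y in lborel. norm (G i y) \<le> B * W y" for i
    proof (rule AE_I2)
      fix y
      show "norm (G i y) \<le> B * W y"
      proof (cases "norm (s i *\<^sub>R y) \<le> r")
        case True
        then show ?thesis using e[OF True] \<phi>(2)[of "\<mu> + s i *\<^sub>R y"] B0
          by (auto simp: G_def abs_mult W_def intro!: mult_mono split: split_indicator)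
      next
        case False
        then show ?thesis using B0 by (auto simp: G_def W_def dist_norm split: split_indicator)
      qed
    qed
  qed measurable
  then show ?th1 by (simp add: eq)
  show ?th2
  proof (rule Bochner_Integration.integrable_bound[OF W])
    show "AE y in lborel. norm (exp (T y)) \<le> norm (W y)"
    proof (rule AE_I2)
      fix y
      \<comment> \<open>Every fixed y eventually lies in the rescaled ball, so the bound there
        passes to the limit.\<close>
      have "exp (T y) \<le> W y"
        by (rule tendsto_upperbound[OF tendsto_exp[OF limF[of y]]])
           (use ev[of y] e in \<open>auto elim!: eventually_mono\<close>)
      then show "norm (exp (T y)) \<le> norm (W y)" by simp
    qed
  qed measurable
qed

section \<open>Laplace asymptotics with several maximum points\<close>

lemma tendsto_powr_times_exp_neg:
  fixes p \<delta> :: real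
  assumes "\<delta> > 0"
  shows "((\<lambda>x. x powr p * exp (- \<delta> * (x - 1))) \<longlongrightarrow> 0) at_top"
  using assms by real_asymp

lemma finite_separated:
  fixes S :: "'a::metric_space set"
  assumes "finite S"
  shows "\<exists>d>0. \<forall>x\<in>S. \<forall>y\<in>S. x \<noteq> y \<longrightarrow> d \<le> dist x y"
proof -
  have "\<forall>x\<in>S. \<exists>d>0. \<forall>y\<in>S. y \<noteq> x \<longrightarrow> d \<le> dist x y"
    using finite_set_avoid[OF assms] by blast
  then obtain d where d: "\<And>x. x \<in> S \<Longrightarrow> d x > 0" "\<And>x y. x \<in> S \<Longrightarrow> y \<in> S \<Longrightarrow> y \<noteq> x \<Longrightarrow> d x \<le> dist x y"
    by metis
  \<comment> \<open>Inserting 1 keeps the minimum well defined when \<open>S\<close> is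
    empty.\<close>
  define e where "e = Min (insert 1 (d ` S))"
  have "e > 0" using assms d(1) by (auto simp: e_def)
  moreover have "e \<le> d x" if "x \<in> S" for x
    using assms that unfolding e_def by (intro Min_le) auto
  ultimately show ?thesis using d(2) by (intro exI[of _ e]) (metis order_trans)
qed

text \<open>The normalization is adapted to \<open>K\<close>. A zero of \<open>F\<close> with
  \<open>kk \<mu> < K\<close> contributes a convergent quantity times a power of N with exponent
  \<open>DIM('a) / (2 * K) - DIM('a) / (2 * kk \<mu>) < 0\<close> and disappears. Away from the
  zeros \<open>F\<close> stays below some \<open>- \<delta>\<close>, and the exponential decay beats
  the power of N.\<close>

lemma laplace_global:
  fixes F \<phi> :: "'a::euclidean_space \<Rightarrow> real" and T :: "'a \<Rightarrow> 'a \<Rightarrow> real" and Ns :: "nat \<Rightarrow> nat" and K :: nat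
  assumes F: "continuous_on UNIV F" "\<And>x. F x \<le> 0"
    and \<phi>: "continuous_on UNIV \<phi>" "\<And>x. \<bar>\<phi> x\<bar> \<le> B"
    and S: "S = {x. F x = 0}" "finite S"
    and kk: "\<And>\<mu>. \<mu> \<in> S \<Longrightarrow> 1 \<le> kk \<mu>" "\<And>\<mu>. \<mu> \<in> S \<Longrightarrow> kk \<mu> \<le> K"
    and bound: "\<And>\<mu>. \<mu> \<in> S \<Longrightarrow> \<exists>r>0. \<exists>c>0. \<forall>y. norm y \<le> r \<longrightarrow> F (\<mu> + y) \<le> - c * norm y ^ (2 * kk \<mu>)"
    and lim: "\<And>\<mu> y. \<mu> \<in> S \<Longrightarrow> ((\<lambda>t. F (\<mu> + t *\<^sub>R y) / t ^ (2 * kk \<mu>)) \<longlongrightarrow> T \<mu> y) (at_right 0)"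
    and coercive: "a > 0" "\<And>x. F x \<le> C - a * (norm x)\<^sup>2"
    and Ns: "filterlim Ns at_top sequentially" "\<And>i. Ns i \<ge> 1"
  shows "(\<lambda>i. real (Ns i) powr (DIM('a) / (2 * real K)) * (\<integral>x. \<phi> x * exp (Ns i * F x) \<partial>lborel))
      \<longlonglongrightarrow> (\<Sum>\<mu>\<in>{\<mu>\<in>S. kk \<mu> = K}. \<phi> \<mu> * (\<integral>y. exp (T \<mu> y) \<partial>lborel))"
proof -
  note [measurable] = borel_measurable_continuous_onI[OF \<phi>(1)] borel_measurable_continuous_onI[OF F(1)]
  have B0: "B \<ge> 0" using \<phi>(2)[of 0] by linarith
  obtain d where d: "d > 0" "\<And>x y. x \<in> S \<Longrightarrow> y \<in> S \<Longrightarrow> x \<noteq> y \<Longrightarrow> d \<le> dist x y"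
    using finite_separated[OF S(2)] by blast
  obtain r0 c where rc: "\<And>\<mu>. \<mu> \<in> S \<Longrightarrow> r0 \<mu> > 0" "\<And>\<mu>. \<mu> \<in> S \<Longrightarrow> c \<mu> > 0"
     "\<And>\<mu> y. \<mu> \<in> S \<Longrightarrow> norm y \<le> r0 \<mu> \<Longrightarrow> F (\<mu> + y) \<le> - c \<mu> * norm y ^ (2 * kk \<mu>)"
    using bound by metis
  \<comment> \<open>Radii of at most a third of the separation distance make the closed balls
    pairwise disjoint.\<close>
  define r where "r = (\<lambda>\<mu>. min (r0 \<mu>) (d / 3))"
  have r: "\<And>\<mu>. \<mu> \<in> S \<Longrightarrow> r \<mu> > 0"
     "\<And>\<mu> y. \<mu> \<in> S \<Longrightarrow> norm y \<le> r \<mu> \<Longrightarrow> F (\<mu> + y) \<le> - c \<mu> * norm y ^ (2 * kk \<mu>)"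
    using rc d by (auto simp: r_def)
  \<comment> \<open>Open balls make \<open>cball 0 R - U\<close> compact, so that \<open>F\<close>
    attains a maximum there; closed balls are the domains of the local integrals.\<close>
  define U where "U = (\<Union>\<mu>\<in>S. ball \<mu> (r \<mu>))"
  define V where "V = (\<Union>\<mu>\<in>S. cball \<mu> (r \<mu>))"
  have [measurable]: "V \<in> sets borel" unfolding V_def using S(2) by auto
  have UV: "U \<subseteq> V" unfolding U_def V_def by force
  have SU: "S \<subseteq> U" unfolding U_def using r(1) by force
  obtain \<delta> where \<delta>: "\<delta> > 0" "\<And>x. x \<notin> V \<Longrightarrow> F x \<le> - \<delta>"
  proof -
    \<comment> \<open>With this radius \<open>a * R\<^sup>2 = \<bar>C\<bar> + 1\<close>, so
      coercivity gives \<open>F x \<le> -1\<close> outside the ball.\<close>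
    define R where "R = sqrt ((\<bar>C\<bar> + 1) / a)"
    define L where "L = cball (0::'a) R - U"
    have far: "F x \<le> -1" if "x \<notin> cball 0 R" for x
    proof -
      have "R\<^sup>2 \<le> (norm x)\<^sup>2" using that coercive(1) by (intro power_mono) (auto simp: R_def)
      then have "(\<bar>C\<bar> + 1) / a \<le> (norm x)\<^sup>2" using coercive(1) by (simp add: R_def)
      then have "\<bar>C\<bar> + 1 \<le> a * (norm x)\<^sup>2" using coercive(1) by (simp add: field_simps)
      with coercive(2)[of x] show ?thesis by linarith
    qed
    have L: "compact L" unfolding L_def U_def by (intro compact_diff) auto
    show ?thesis
    proof (cases "L = {}")
      case True
      then have "x \<notin> cball 0 R" if "x \<notin> V" for x using that UV unfolding L_def by blast
      then show ?thesis using far that[of 1] by simp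
    next
      case False
      obtain z where z: "z \<in> L" "\<And>x. x \<in> L \<Longrightarrow> F x \<le> F z"
        using continuous_attains_sup[OF L False continuous_on_subset[OF F(1)]] by auto
      have "F z < 0" using z(1) SU F(2)[of z] unfolding L_def S(1) by force
      have "F x \<le> - min 1 (- F z)" if "x \<notin> V" for x
      proof -
        have "x \<notin> U" using that UV by blast
        then show ?thesis using z(2)[of x] far[of x] by (cases "x \<in> cball 0 R") (auto simp: L_def)
      qed
      then show ?thesis using \<open>F z < 0\<close> that[of "min 1 (- F z)"] by simp
    qed
  qed
  have intF: "integrable lborel (\<lambda>x. exp (F x))"
  proof (rule Bochner_Integration.integrable_bound[where f="\<lambda>x. exp C * exp (- a * (norm x)\<^sup>2)"])
    show "integrable lborel (\<lambda>x::'a. exp C * exp (- a * (norm x)\<^sup>2))"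
      using integrable_gaussian[OF coercive(1)] by simp
  qed (use coercive(2) in \<open>auto simp: exp_add[symmetric]\<close>)
  have le: "exp (real (Ns i) * F x) \<le> exp (F x)" for i x
    using mult_right_mono_neg[of 1 "real (Ns i)" "F x"] Ns(2)[of i] F(2)[of x] by simp
  have intN: "integrable lborel (\<lambda>x. indicator A x * (\<phi> x * exp (Ns i * F x)))" if [measurable]: "A \<in> sets borel" for A i
  proof (rule Bochner_Integration.integrable_bound[where f="\<lambda>x. B * exp (F x)"])
    show "integrable lborel (\<lambda>x. B * exp (F x))" using intF by simp
    show "AE x in lborel. norm (indicator A x * (\<phi> x * exp (Ns i * F x))) \<le> norm (B * exp (F x))"
      using le \<phi>(2) B0 by (intro AE_I2) (auto simp: abs_mult indicator_def intro!: mult_mono)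
  qed measurable
  have decomp: "(\<integral>x. \<phi> x * exp (Ns i * F x) \<partial>lborel) =
     (\<Sum>\<mu>\<in>S. \<integral>x. indicator (cball \<mu> (r \<mu>)) x * (\<phi> x * exp (Ns i * F x)) \<partial>lborel)
     + (\<integral>x. indicator (- V) x * (\<phi> x * exp (Ns i * F x)) \<partial>lborel)" for i
  proof -
    have "disjoint_family_on (\<lambda>\<mu>. cball \<mu> (r \<mu>)) S"
    proof (unfold disjoint_family_on_def, intro ballI impI equals0I)
      fix x y z assume *: "x \<in> S" "y \<in> S" "x \<noteq> y" "z \<in> cball x (r x) \<inter> cball y (r y)"
      then have "dist x z \<le> d/3" "dist y z \<le> d/3" by (auto simp: r_def)
      with dist_triangle2[of x y z] d(2)[OF *(1-3)] d(1) show False by linarith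
    qed
    then have ind: "indicator V x = (\<Sum>\<mu>\<in>S. indicator (cball \<mu> (r \<mu>)) x :: real)" for x
      unfolding V_def by (rule indicator_UN_disjoint[OF S(2)])
    have "\<phi> x * exp (Ns i * F x) = (\<Sum>\<mu>\<in>S. indicator (cball \<mu> (r \<mu>)) x * (\<phi> x * exp (Ns i * F x)))
       + indicator (- V) x * (\<phi> x * exp (Ns i * F x))" for x
      unfolding sum_distrib_right[symmetric] ind[symmetric] by (auto simp: indicator_def)
    then have "(\<integral>x. \<phi> x * exp (Ns i * F x) \<partial>lborel) = (\<integral>x. (\<Sum>\<mu>\<in>S. indicator (cball \<mu> (r \<mu>)) x * (\<phi> x * exp (Ns i * F x)))
       + indicator (- V) x * (\<phi> x * exp (Ns i * F x)) \<partial>lborel)"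
      by (rule Bochner_Integration.integral_cong[OF refl])
    also have "\<dots> = (\<Sum>\<mu>\<in>S. \<integral>x. indicator (cball \<mu> (r \<mu>)) x * (\<phi> x * exp (Ns i * F x)) \<partial>lborel)
     + (\<integral>x. indicator (- V) x * (\<phi> x * exp (Ns i * F x)) \<partial>lborel)"
      by (subst Bochner_Integration.integral_add, intro Bochner_Integration.integrable_sum intN)
         (auto intro!: intN Bochner_Integration.integral_sum)
    finally show ?thesis .
  qed
  define p where "p = real DIM('a) / (2 * real K)"
  have Nr: "filterlim (\<lambda>i. real (Ns i)) at_top sequentially"
    using filterlim_compose[OF filterlim_real_sequentially Ns(1)] .
  have out: "(\<lambda>i. real (Ns i) powr p * (\<integral>x. indicator (- V) x * (\<phi> x * exp (Ns i * F x)) \<partial>lborel)) \<longlonglongrightarrow> 0"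
  proof (rule Lim_null_comparison[OF always_eventually, OF allI])
    have "(\<lambda>i. B * (\<integral>x. exp (F x) \<partial>lborel) * (real (Ns i) powr p * exp (- \<delta> * (real (Ns i) - 1)))) \<longlonglongrightarrow> B * (\<integral>x. exp (F x) \<partial>lborel) * 0"
      by (intro tendsto_mult tendsto_const filterlim_compose[OF tendsto_powr_times_exp_neg[OF \<delta>(1)] Nr])
    then show "(\<lambda>i. B * (\<integral>x. exp (F x) \<partial>lborel) * (real (Ns i) powr p * exp (- \<delta> * (real (Ns i) - 1)))) \<longlonglongrightarrow> 0"
      by simp
    fix i
    have "norm (\<integral>x. indicator (- V) x * (\<phi> x * exp (Ns i * F x)) \<partial>lborel)
       \<le> (\<integral>x. (B * exp (- \<delta> * (real (Ns i) - 1))) * exp (F x) \<partial>lborel)"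
    proof (rule Bochner_Integration.integral_norm_bound_integral)
      show "norm (indicator (- V) x * (\<phi> x * exp (Ns i * F x))) \<le> (B * exp (- \<delta> * (real (Ns i) - 1))) * exp (F x)" for x
      proof (cases "x \<in> V")
        case False
        \<comment> \<open>One copy of \<open>F x\<close> is kept back to ensure integrability; the
          other \<open>Ns i - 1\<close> copies are bounded by \<open>- \<delta>\<close>. This is the
          origin of the shift by 1 in the exponential.\<close>
        have "real (Ns i) * F x \<le> - \<delta> * (real (Ns i) - 1) + F x"
          using mult_right_mono[OF \<delta>(2)[OF False], of "real (Ns i) - 1"] Ns(2)[of i] by (simp add: algebra_simps)
        then have "exp (real (Ns i) * F x) \<le> exp (- \<delta> * (real (Ns i) - 1)) * exp (F x)"
          by (simp add: exp_add[symmetric])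
        then have "\<bar>\<phi> x\<bar> * exp (real (Ns i) * F x) \<le> B * (exp (- \<delta> * (real (Ns i) - 1)) * exp (F x))"
          using \<phi>(2)[of x] B0 by (intro mult_mono) auto
        then show ?thesis using False by (simp add: abs_mult mult.assoc)
      qed (use B0 in auto)
    qed (use intF intN[of "- V"] in auto)
    then have "real (Ns i) powr p * norm (\<integral>x. indicator (- V) x * (\<phi> x * exp (Ns i * F x)) \<partial>lborel)
       \<le> real (Ns i) powr p * ((B * exp (- \<delta> * (real (Ns i) - 1))) * (\<integral>x. exp (F x) \<partial>lborel))"
      by (intro mult_left_mono) auto
    then show "norm (real (Ns i) powr p * (\<integral>x. indicator (- V) x * (\<phi> x * exp (Ns i * F x)) \<partial>lborel))
       \<le> B * (\<integral>x. exp (F x) \<partial>lborel) * (real (Ns i) powr p * exp (- \<delta> * (real (Ns i) - 1)))"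
      by (simp add: abs_mult mult_ac)
  qed
  have inn: "(\<lambda>i. real (Ns i) powr p * (\<integral>x. indicator (cball \<mu> (r \<mu>)) x * (\<phi> x * exp (Ns i * F x)) \<partial>lborel))
     \<longlonglongrightarrow> (if kk \<mu> = K then \<phi> \<mu> * (\<integral>y. exp (T \<mu> y) \<partial>lborel) else 0)" if \<mu>: "\<mu> \<in> S" for \<mu>
  proof -
    define k where "k = kk \<mu>"
    have k: "k \<ge> 1" "k \<le> K" using kk[OF \<mu>] by (auto simp: k_def)
    define s where "s = (\<lambda>i. real (Ns i) powr (- 1 / (2 * k)))"
    have Npos: "real (Ns i) > 0" for i using Ns(2)[of i] by simp
    have s: "\<And>i. s i > 0" using Npos by (simp add: s_def)
    have s0: "s \<longlonglongrightarrow> 0" unfolding s_def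
      using k by (intro tendsto_neg_powr Nr) simp
    have sk: "x / s i ^ (2*k) = Ns i * x" for i and x :: real
    proof -
      have "s i ^ (2*k) = real (Ns i) powr (- 1 / (2 * k) * real (2*k))"
        unfolding s_def using Npos[of i] by (simp only: powr_powr[symmetric] powr_realpow[OF powr_gt_zero[THEN iffD2]])
      also have "- 1 / real (2 * k) * real (2*k) = -1" using k by simp
      finally have "s i ^ (2*k) = 1 / real (Ns i)" using Npos[of i] by (simp add: powr_minus_divide)
      then show ?thesis by simp
    qed
    \<comment> \<open>The global normalization splits into the one natural for type k and a
      remaining power of N, which is 1 for \<open>k = K\<close> and tends to 0 for
      \<open>k < K\<close>.\<close>
    have sd: "real (Ns i) powr p = (1 / s i ^ DIM('a)) * real (Ns i) powr (p - DIM('a) / (2 * k))" for i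
    proof -
      have "s i ^ DIM('a) = real (Ns i) powr (- 1 / real (2 * k) * DIM('a))"
        unfolding s_def using Npos[of i] by (simp only: powr_powr[symmetric] powr_realpow[OF powr_gt_zero[THEN iffD2]])
      then have "s i ^ DIM('a) = 1 / real (Ns i) powr (DIM('a) / (2 * k))"
        by (simp add: powr_minus_divide)
      then show ?thesis using Npos[of i] by (simp add: powr_diff)
    qed
    have "(\<lambda>i. (\<integral>x. indicator (cball \<mu> (r \<mu>)) x * (\<phi> x * exp (F x / s i ^ (2*k))) \<partial>lborel) / s i ^ DIM('a))
            \<longlonglongrightarrow> \<phi> \<mu> * (\<integral>y. exp (T \<mu> y) \<partial>lborel)"
      using laplace_local(1)[OF _ \<phi> k(1) r(1)[OF \<mu>] rc(2)[OF \<mu>], where F=F and T="T \<mu>" and s=s, folded k_def, OF _ _ lim[OF \<mu>, folded k_def] s s0]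
         r(2)[OF \<mu>, folded k_def] by measurable
    then have l: "(\<lambda>i. (\<integral>x. indicator (cball \<mu> (r \<mu>)) x * (\<phi> x * exp (Ns i * F x)) \<partial>lborel) / s i ^ DIM('a))
            \<longlonglongrightarrow> \<phi> \<mu> * (\<integral>y. exp (T \<mu> y) \<partial>lborel)"
      by (simp only: sk)
    show ?thesis
    proof (cases "k = K")
      case True
      have "real (Ns i) powr p = 1 / s i ^ DIM('a)" for i
        using sd[of i] Npos[of i] True by (simp add: p_def)
      then show ?thesis using l True by (simp add: k_def)
    next
      case False
      have "p - DIM('a) / (2 * k) < 0"
        using k False by (simp add: p_def divide_strict_left_mono)
      from tendsto_neg_powr[OF this Nr]
      have "(\<lambda>i. real (Ns i) powr (p - DIM('a) / (2 * k))) \<longlonglongrightarrow> 0" .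
      from tendsto_mult[OF l this] show ?thesis using False by (simp add: sd k_def mult_ac)
    qed
  qed
  have "(\<lambda>i. (\<Sum>\<mu>\<in>S. real (Ns i) powr p * (\<integral>x. indicator (cball \<mu> (r \<mu>)) x * (\<phi> x * exp (Ns i * F x)) \<partial>lborel))
      + real (Ns i) powr p * (\<integral>x. indicator (- V) x * (\<phi> x * exp (Ns i * F x)) \<partial>lborel))
    \<longlonglongrightarrow> (\<Sum>\<mu>\<in>S. if kk \<mu> = K then \<phi> \<mu> * (\<integral>y. exp (T \<mu> y) \<partial>lborel) else 0) + 0"
    by (intro tendsto_add tendsto_sum inn out)
  then show ?thesis
    by (simp add: decomp p_def distrib_left sum_distrib_left sum.inter_filter[OF S(2)])
qed

section \<open>Homogeneous types\<close>

text \<open>With two different types, the term whose degree is twice the smaller one would have to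
  vanish identically and yet be negative at nonzero vectors. Such vectors exist because the index
  type is inhabited. This gives the definite description in \<open>hom_type\<close> its
  meaning.\<close>

lemma has_hom_type_unique:
  fixes F :: "real^'n::finite \<Rightarrow> real"
  assumes "has_hom_type F \<mu> k" "has_hom_type F \<mu> k'"
  shows "k = k'"
proof (rule ccontr)
  obtain y :: "real^'n" where y: "y \<noteq> 0" by (metis axis_eq_0_iff zero_neq_one)
  assume "k \<noteq> k'"
  then consider "k < k'" | "k' < k" by linarith
  then show False
  proof cases
    case 1
    then have "2 * k \<in> {1..2*k'-1}" using assms unfolding has_hom_type_def by auto
    then have "taylor_term F \<mu> (2*k) y = 0" using assms(2) unfolding has_hom_type_def by blast
    moreover have "taylor_term F \<mu> (2*k) y < 0" using assms(1) y unfolding has_hom_type_def by blast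
    ultimately show False by simp
  next
    case 2
    then have "2 * k' \<in> {1..2*k-1}" using assms unfolding has_hom_type_def by auto
    then have "taylor_term F \<mu> (2*k') y = 0" using assms(1) unfolding has_hom_type_def by blast
    moreover have "taylor_term F \<mu> (2*k') y < 0" using assms(2) y unfolding has_hom_type_def by blast
    ultimately show False by simp
  qed
qed

lemma hom_type_eq: "has_hom_type F \<mu> k \<Longrightarrow> hom_type F \<mu> = k"
  unfolding hom_type_def by (rule the_equality) (auto intro: has_hom_type_unique)

text \<open>The Lagrange remainder is taken at order \<open>2 * k\<close> itself, so that joint continuity of that
  derivative gives both the directional limit and, by compactness of the sphere, the uniform bound.\<close>

lemma has_hom_type_expansion:
  fixes F :: "real^'n::finite \<Rightarrow> real" and D :: "nat \<Rightarrow> real^'n \<Rightarrow> real \<Rightarrow> real"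
  assumes D0: "\<And>y t. D 0 y t = F (\<mu> + t *\<^sub>R y)"
    and D: "\<And>j y t. (D j y has_real_derivative D (Suc j) y t) (at t)"
    and cont: "\<And>j. continuous_on UNIV (\<lambda>p. D j (fst p) (snd p))"
    and ht: "has_hom_type F \<mu> k"
  shows "((\<lambda>t. (F (\<mu> + t *\<^sub>R y) - F \<mu>) / t ^ (2*k)) \<longlongrightarrow> taylor_term F \<mu> (2*k) y) (at_right 0)" (is ?lim)
    and "\<exists>r>0. \<exists>c>0. \<forall>y. norm y \<le> r \<longrightarrow> F (\<mu> + y) - F \<mu> \<le> - c * norm y ^ (2*k)" (is ?bound)
proof -
  have k: "k \<ge> 1" using ht by (simp add: has_hom_type_def)
  have iter: "(deriv ^^ j) (\<lambda>t. F (\<mu> + t *\<^sub>R y)) = D j y" for j y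
  proof (induction j)
    case 0
    show ?case by (simp add: D0 fun_eq_iff)
  next
    case (Suc j)
    have "deriv (D j y) = D (Suc j) y" using DERIV_imp_deriv[OF D] by (auto simp: fun_eq_iff)
    then show ?case by (simp add: Suc)
  qed
  have tt: "taylor_term F \<mu> j y = D j y 0 / fact j" for j y
    by (simp add: taylor_term_def iter)
  have exp: "\<exists>u. \<bar>u\<bar> \<le> \<bar>t\<bar> \<and> F (\<mu> + t *\<^sub>R y) - F \<mu> = D (2*k) y u / fact (2*k) * t ^ (2*k)" for t y
  proof -
    obtain u where u: "\<bar>u\<bar> \<le> \<bar>t\<bar>" "D 0 y t = (\<Sum>m<2*k. D m y 0 / fact m * t ^ m) + D (2*k) y u / fact (2*k) * t ^ (2*k)"
      using Maclaurin_all_le[of "\<lambda>m. D m y" "D 0 y" t "2*k"] D by blast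
    have "D m y 0 = 0" if "m \<in> {..<2*k} - {0}" for m
    proof -
      have "m \<in> {1..2*k-1}" using that by auto
      then have "taylor_term F \<mu> m y = 0" using ht unfolding has_hom_type_def by blast
      then show ?thesis by (simp add: tt)
    qed
    then have "(\<Sum>m<2*k. D m y 0 / fact m * t ^ m) = (\<Sum>m\<in>{0}. D m y 0 / fact m * t ^ m)"
      using k by (intro sum.mono_neutral_right) auto
    then show ?thesis using u by (intro exI[of _ u]) (simp add: D0)
  qed
  show ?lim
  proof -
    obtain u where u: "\<And>t. \<bar>u t\<bar> \<le> \<bar>t\<bar>" "\<And>t. F (\<mu> + t *\<^sub>R y) - F \<mu> = D (2*k) y (u t) / fact (2*k) * t ^ (2*k)"
      using exp[of _ y] by metis
    have "(u \<longlongrightarrow> 0) (at_right 0)"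
      by (rule Lim_null_comparison[where g="\<lambda>t. \<bar>t\<bar>"])
         (auto intro!: always_eventually u tendsto_eq_intros)
    moreover have "isCont (D (2*k) y) 0" using D DERIV_isCont by blast
    ultimately have "((\<lambda>t. D (2*k) y (u t)) \<longlongrightarrow> D (2*k) y 0) (at_right 0)"
      by (rule isCont_tendsto_compose[rotated])
    then have "((\<lambda>t. D (2*k) y (u t) / fact (2*k)) \<longlongrightarrow> taylor_term F \<mu> (2*k) y) (at_right 0)"
      unfolding tt by (intro tendsto_intros) auto
    moreover have "\<forall>\<^sub>F t in at_right 0. D (2*k) y (u t) / fact (2*k) = (F (\<mu> + t *\<^sub>R y) - F \<mu>) / t ^ (2*k)"
      by (auto simp: eventually_at_filter u(2))
    ultimately show ?thesis by (rule Lim_transform_eventually)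
  qed
  show ?bound
  proof -
    define S where "S = sphere (0::real^'n) 1"
    define E where "E = (\<lambda>p. D (2*k) (fst p) (snd p) / fact (2*k))"
    have contE: "continuous_on A E" for A
      unfolding E_def by (intro continuous_intros continuous_on_subset[OF cont]) auto
    have S: "compact S" "S \<noteq> {}" by (auto simp: S_def)
    obtain z where z: "z \<in> S" "\<And>y. y \<in> S \<Longrightarrow> E (y, 0) \<le> E (z, 0)"
    proof -
      have "continuous_on S (\<lambda>y. E (y, 0))"
        by (rule continuous_on_compose2[OF contE[of UNIV]]) (auto intro!: continuous_intros)
      then show ?thesis using continuous_attains_sup[OF S] that by blast
    qed
    have "z \<noteq> 0" using z(1) by (auto simp: S_def)
    then have neg: "E (z, 0) < 0"
      using ht unfolding has_hom_type_def by (auto simp: E_def tt)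
    \<comment> \<open>Half of the negative maximum on the sphere is retained as the decay constant;
      the other half pays for evaluating the derivative at the intermediate point u instead of at
      0.\<close>
    define c where "c = - E (z, 0) / 2"
    have c: "c > 0" using neg by (simp add: c_def)
    have "uniformly_continuous_on (S \<times> {-1..1}) E"
      by (intro compact_uniformly_continuous contE compact_Times S) auto
    then obtain d where d: "d > 0" "\<And>p q. p \<in> S \<times> {-1..1} \<Longrightarrow> q \<in> S \<times> {-1..1} \<Longrightarrow> dist q p < d \<Longrightarrow> dist (E q) (E p) < c"
      using c unfolding uniformly_continuous_on_def by metis
    \<comment> \<open>The 1 keeps the intermediate point in \<open>{-1..1}\<close>, where the
      uniform continuity holds; \<open>d / 2\<close> makes it strictly closer to 0 than d.\<close>
    define r where "r = min 1 (d / 2)"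
    have r: "r > 0" "r \<le> 1" "r < d" using d(1) by (auto simp: r_def)
    have "F (\<mu> + y) - F \<mu> \<le> - c * norm y ^ (2*k)" if y: "norm y \<le> r" for y
    proof (cases "y = 0")
      case True
      then show ?thesis using k by (simp add: zero_power)
    next
      case False
      define v where "v = y /\<^sub>R norm y"
      have v: "v \<in> S" "norm y *\<^sub>R v = y" using False by (auto simp: v_def S_def)
      obtain u where u: "\<bar>u\<bar> \<le> norm y" "F (\<mu> + y) - F \<mu> = E (v, u) * norm y ^ (2*k)"
        using exp[of "norm y" v] v(2) by (auto simp: E_def)
      have "dist (E (v, u)) (E (v, 0)) < c"
        using u(1) y r v(1) by (intro d(2)) (auto simp: dist_Pair_Pair dist_real_def)
      then have "E (v, u) \<le> - c" using z(2)[OF v(1)] by (auto simp: c_def dist_real_def)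
      then show ?thesis unfolding u(2) by (intro mult_right_mono) auto
    qed
    then show ?thesis using r(1) c by blast
  qed
qed

section \<open>The function f\<close>

text \<open>The derivatives of \<open>ln \<circ> cosh\<close> are polynomials in tanh, because of \<open>tanh' = 1 - tanh\<^sup>2\<close>.\<close>

primrec tanh_poly :: "nat \<Rightarrow> real poly" where
  "tanh_poly 0 = [:0, 1:]"
| "tanh_poly (Suc j) = pderiv (tanh_poly j) * [:1, 0, -1:]"

definition ln_cosh_deriv :: "nat \<Rightarrow> real \<Rightarrow> real" where
  "ln_cosh_deriv j x = (case j of 0 \<Rightarrow> ln (cosh x) | Suc i \<Rightarrow> poly (tanh_poly i) (tanh x))"

lemma DERIV_ln_cosh_deriv: "(ln_cosh_deriv j has_real_derivative ln_cosh_deriv (Suc j) x) (at x)"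
proof (cases j)
  case 0
  have "((\<lambda>x. ln (cosh x)) has_real_derivative tanh x) (at x)"
    by (auto intro!: derivative_eq_intros simp: tanh_def divide_simps)
  then show ?thesis by (simp add: 0 ln_cosh_deriv_def[abs_def])
next
  case (Suc i)
  have "((\<lambda>x. poly (tanh_poly i) (tanh x)) has_real_derivative poly (pderiv (tanh_poly i)) (tanh x) * (1 - tanh x ^ 2)) (at x)"
    by (rule DERIV_chain2[OF poly_DERIV]) (auto intro!: derivative_eq_intros)
  then show ?thesis by (simp add: Suc ln_cosh_deriv_def[abs_def] power2_eq_square algebra_simps)
qed

lemma continuous_on_ln_cosh_deriv: "continuous_on A (ln_cosh_deriv j)"
  using DERIV_ln_cosh_deriv DERIV_isCont continuous_at_imp_continuous_on by blast

lemma ln_cosh_le_abs: "ln (cosh x) \<le> \<bar>x::real\<bar>"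
proof -
  have "cosh x \<le> exp \<bar>x\<bar>" unfolding cosh_def by (cases "x \<ge> 0") auto
  then show ?thesis by (simp add: ln_le_cancel_iff[symmetric] del: ln_le_cancel_iff)
qed

section \<open>The quadratic form of the interaction and the growth of f\<close>

definition block_matrix :: "('n::finite \<Rightarrow> real) \<Rightarrow> ('n \<Rightarrow> 'n \<Rightarrow> real) \<Rightarrow> real^'n^'n" where
  "block_matrix \<alpha> J = (\<chi> l s. \<alpha> l * \<alpha> s * J l s)"

text \<open>Row l gives the interaction part of the field felt by a spin of block l. Unlike
  \<open>block_matrix\<close>, which for symmetric \<open>J\<close> is the Hessian of
  \<open>g_fun\<close>, this matrix is in general not symmetric, so the two are kept apart.\<close>

definition field_matrix :: "('n::finite \<Rightarrow> real) \<Rightarrow> ('n \<Rightarrow> 'n \<Rightarrow> real) \<Rightarrow> real^'n^'n" where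
  "field_matrix \<alpha> J = (\<chi> l s. \<alpha> s * J l s)"

lemma field_matrix_nth: "(field_matrix \<alpha> J *v x) $ l = (\<Sum>s\<in>UNIV. \<alpha> s * J l s * x $ s)"
  by (simp add: field_matrix_def matrix_vector_mult_def)

lemma block_matrix_nth: "(block_matrix \<alpha> J *v x) $ l = \<alpha> l * (field_matrix \<alpha> J *v x) $ l"
  by (simp add: field_matrix_def block_matrix_def matrix_vector_mult_def sum_distrib_left mult_ac)

lemma quadratic_form_block_matrix:
  "(\<Sum>l\<in>UNIV. \<Sum>s\<in>UNIV. \<alpha> l * \<alpha> s * J l s * x $ l * x $ s) = x \<bullet> (block_matrix \<alpha> J *v x)"
  by (simp add: inner_vec_def block_matrix_def matrix_vector_mult_def sum_distrib_left mult_ac)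

lemma f_fun_eq:
  "f_fun \<alpha> J h x = - (1/2) * (x \<bullet> (block_matrix \<alpha> J *v x))
     + (\<Sum>l\<in>UNIV. \<alpha> l * ln (cosh ((field_matrix \<alpha> J *v x) $ l + h l)))"
  unfolding f_fun_def quadratic_form_block_matrix field_matrix_nth ..

lemma block_matrix_symmetric:
  assumes "\<forall>l s. J l s = J s l"
  shows "x \<bullet> (block_matrix \<alpha> J *v y) = y \<bullet> (block_matrix \<alpha> J *v x)"
proof -
  have "transpose (block_matrix \<alpha> J) = block_matrix \<alpha> J"
    using assms by (simp add: transpose_def block_matrix_def vec_eq_iff mult_ac)
  then show ?thesis by (metis dot_lmul_matrix inner_commute vector_transpose_matrix)
qed

text \<open>The form at x is that of \<open>J\<close> at the vector with entries
  \<open>\<alpha> l * x $ l\<close>, hence positive off 0. Its minimum over the unit sphere is then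
  a positive constant, and quadratic homogeneity extends the bound to all vectors.\<close>

lemma block_matrix_coercive:
  fixes \<alpha> :: "'n::finite \<Rightarrow> real"
  assumes "\<forall>l. 0 < \<alpha> l" and pd: "\<forall>x :: 'n \<Rightarrow> real. x \<noteq> (\<lambda>_. 0) \<longrightarrow> (\<Sum>l\<in>UNIV. \<Sum>s\<in>UNIV. J l s * x l * x s) > 0"
  shows "\<exists>a>0. \<forall>x. a * (norm x)\<^sup>2 \<le> x \<bullet> (block_matrix \<alpha> J *v x)"
proof -
  define q where "q = (\<lambda>x. x \<bullet> (block_matrix \<alpha> J *v x))"
  have pos: "q x > 0" if "x \<noteq> 0" for x
  proof -
    obtain l where "x $ l \<noteq> 0" using \<open>x \<noteq> 0\<close> by (auto simp: vec_eq_iff)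
    then have "\<alpha> l * x $ l \<noteq> 0" using assms(1) by (metis less_irrefl mult_eq_0_iff)
    then have "(\<lambda>l. \<alpha> l * x $ l) \<noteq> (\<lambda>_. 0)" by metis
    from pd[rule_format, OF this] show ?thesis
      unfolding q_def quadratic_form_block_matrix[symmetric] by (simp add: mult_ac)
  qed
  have S: "compact (sphere (0::real^'n) 1)" "sphere (0::real^'n) 1 \<noteq> {}" by auto
  have "continuous_on (sphere 0 1) q"
    unfolding q_def by (intro continuous_intros)
  then obtain z where z: "norm z = 1" "\<And>y. norm y = 1 \<Longrightarrow> q z \<le> q y"
    using continuous_attains_inf[OF S, of q] by auto
  have "q z * (norm x)\<^sup>2 \<le> q x" for x
  proof (cases "x = 0")
    case False
    have "q z \<le> q (x /\<^sub>R norm x)" using False by (intro z(2)) simp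
    also have "\<dots> = q x / (norm x)\<^sup>2"
      by (simp add: q_def matrix_vector_mult_scaleR power2_eq_square divide_inverse)
    finally show ?thesis using False by (simp add: field_simps)
  qed (simp add: q_def)
  moreover have "q z > 0" using z(1) by (intro pos) auto
  ultimately show ?thesis unfolding q_def by blast
qed

lemma continuous_on_f_fun: "continuous_on A (f_fun \<alpha> J h)"
proof -
  have "f_fun \<alpha> J h = (\<lambda>x. - (1/2) * (x \<bullet> (block_matrix \<alpha> J *v x))
     + (\<Sum>l\<in>UNIV. \<alpha> l * ln_cosh_deriv 0 ((field_matrix \<alpha> J *v x) $ l + h l)))"
    by (simp add: f_fun_eq ln_cosh_deriv_def fun_eq_iff)
  then show ?thesis
    by (auto intro!: continuous_intros continuous_on_compose2[OF continuous_on_ln_cosh_deriv[of UNIV]])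
qed

text \<open>The logarithmic terms grow at most linearly, by \<open>ln_cosh_le_abs\<close>, so the
  negative definite quadratic form wins.\<close>

lemma f_fun_coercive:
  fixes \<alpha> :: "'n::finite \<Rightarrow> real"
  assumes "\<forall>l. 0 < \<alpha> l" and "\<forall>x :: 'n \<Rightarrow> real. x \<noteq> (\<lambda>_. 0) \<longrightarrow> (\<Sum>l\<in>UNIV. \<Sum>s\<in>UNIV. J l s * x l * x s) > 0"
  shows "\<exists>a>0. \<exists>C. \<forall>x. f_fun \<alpha> J h x \<le> C - a * (norm x)\<^sup>2"
proof -
  obtain a where a: "a > 0" "\<And>x. a * (norm x)\<^sup>2 \<le> x \<bullet> (block_matrix \<alpha> J *v x)"
    using block_matrix_coercive[OF assms] by blast
  obtain b where b: "\<And>x. norm (field_matrix \<alpha> J *v x) \<le> norm x * b"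
    using bounded_linear.bounded[OF matrix_vector_mul_bounded_linear] by blast
  define A where "A = (\<Sum>l\<in>UNIV. \<alpha> l)"
  define H where "H = (\<Sum>l\<in>UNIV. \<alpha> l * \<bar>h l\<bar>)"
  have "f_fun \<alpha> J h x \<le> (H + (A * b)\<^sup>2 / a) - (a / 4) * (norm x)\<^sup>2" for x
  proof -
    have "\<alpha> l * ln (cosh ((field_matrix \<alpha> J *v x) $ l + h l)) \<le> \<alpha> l * (norm x * b + \<bar>h l\<bar>)" for l
    proof (rule mult_left_mono)
      show "ln (cosh ((field_matrix \<alpha> J *v x) $ l + h l)) \<le> norm x * b + \<bar>h l\<bar>"
        using ln_cosh_le_abs[of "(field_matrix \<alpha> J *v x) $ l + h l"]
          component_le_norm_cart[of "field_matrix \<alpha> J *v x" l] b[of x] by linarith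
    qed (use assms(1) in \<open>auto simp: less_imp_le\<close>)
    then have "(\<Sum>l\<in>UNIV. \<alpha> l * ln (cosh ((field_matrix \<alpha> J *v x) $ l + h l))) \<le> (\<Sum>l\<in>UNIV. \<alpha> l * (norm x * b + \<bar>h l\<bar>))"
      by (rule sum_mono)
    also have "\<dots> = A * b * norm x + H"
      by (simp add: distrib_left sum.distrib A_def H_def sum_distrib_right sum_distrib_left mult_ac)
    finally have "f_fun \<alpha> J h x \<le> - (a / 2) * (norm x)\<^sup>2 + A * b * norm x + H"
      using a(2)[of x] unfolding f_fun_eq by linarith
    \<comment> \<open>Young's inequality: half of the available coefficient \<open>a / 2\<close>
      absorbs the linear term, which leaves \<open>a / 4\<close>.\<close>
    moreover have "A * b * norm x \<le> (A * b)\<^sup>2 / a + (a / 4) * (norm x)\<^sup>2"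
    proof -
      have "0 \<le> (a / 2 * norm x - A * b)\<^sup>2 / a" using a(1) by simp
      also have "\<dots> = (A * b)\<^sup>2 / a + (a / 4) * (norm x)\<^sup>2 - A * b * norm x"
        using a(1) by (simp add: power2_diff power_mult_distrib power2_eq_square field_simps)
      finally show ?thesis by simp
    qed
    ultimately show ?thesis by linarith
  qed
  moreover have "a / 4 > 0" using a(1) by simp
  ultimately show ?thesis by blast
qed

section \<open>Maximum points of coercive functions\<close>

lemma coercive_attains_global_max:
  fixes F :: "'a::euclidean_space \<Rightarrow> real"
  assumes "continuous_on UNIV F" and a: "a > 0" "\<And>x. F x \<le> C - a * (norm x)\<^sup>2"
  shows "\<exists>z. \<forall>x. F x \<le> F z" and "bounded {z. \<forall>x. F x \<le> F z}"
proof -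
  \<comment> \<open>The radius is chosen so that all values outside the ball fall below the
    reference value \<open>F 0\<close>.\<close>
  define R where "R = sqrt ((\<bar>C\<bar> + \<bar>F 0\<bar> + 1) / a)"
  have far: "F x < F 0" if "x \<notin> cball 0 R" for x
  proof -
    have "R\<^sup>2 \<le> (norm x)\<^sup>2" using that a(1) by (intro power_mono) (auto simp: R_def)
    then have "(\<bar>C\<bar> + \<bar>F 0\<bar> + 1) / a \<le> (norm x)\<^sup>2" using a(1) by (simp add: R_def)
    then have "\<bar>C\<bar> + \<bar>F 0\<bar> + 1 \<le> a * (norm x)\<^sup>2" using a(1) by (simp add: field_simps)
    with a(2)[of x] show ?thesis by linarith
  qed
  have R: "R \<ge> 0" using a(1) by (simp add: R_def)
  obtain z where z: "z \<in> cball 0 R" "\<And>x. x \<in> cball 0 R \<Longrightarrow> F x \<le> F z"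
    using continuous_attains_sup[of "cball 0 R" F] continuous_on_subset[OF assms(1)] R by auto
  have "F 0 \<le> F z" using z(2)[of 0] R by simp
  then show "\<exists>z. \<forall>x. F x \<le> F z" using z(2) far by (metis less_imp_le order_trans)
  have "{z. \<forall>x. F x \<le> F z} \<subseteq> cball 0 R" using far by (force simp: not_le[symmetric])
  then show "bounded {z. \<forall>x. F x \<le> F z}" by (rule bounded_subset[OF bounded_cball])
qed

text \<open>The maximum points form a closed set, bounded by coercivity, and \<open>iso\<close>
  forbids limit points inside it; a compact set without limit points of its own is finite.\<close>

lemma finite_global_max:
  fixes F :: "'a::euclidean_space \<Rightarrow> real"
  assumes F: "continuous_on UNIV F" and a: "a > 0" "\<And>x. F x \<le> C - a * (norm x)\<^sup>2"
    and iso: "\<And>\<mu>. (\<forall>x. F x \<le> F \<mu>) \<Longrightarrow> \<exists>r>0. \<forall>y. y \<noteq> 0 \<longrightarrow> norm y \<le> r \<longrightarrow> F (\<mu> + y) < F \<mu>"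
  shows "finite {\<mu>. \<forall>x. F x \<le> F \<mu>}"
proof -
  define S where "S = {\<mu>. \<forall>x. F x \<le> F \<mu>}"
  have "S = (\<Inter>x. {\<mu>. F x \<le> F \<mu>})" by (auto simp: S_def)
  moreover have "closed {\<mu>. F x \<le> F \<mu>}" for x
    by (intro closed_Collect_le continuous_intros F)
  ultimately have "closed S" by auto
  moreover have "bounded S" unfolding S_def by (rule coercive_attains_global_max(2)[OF F a])
  ultimately have "compact S" by (simp add: compact_eq_bounded_closed)
  moreover have "\<not> \<mu> islimpt S" if "\<mu> \<in> S" for \<mu>
  proof -
    obtain r where r: "r > 0" "\<And>y. y \<noteq> 0 \<Longrightarrow> norm y \<le> r \<Longrightarrow> F (\<mu> + y) < F \<mu>"
      using iso[of \<mu>] \<open>\<mu> \<in> S\<close> by (auto simp: S_def)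
    show ?thesis
    proof
      assume "\<mu> islimpt S"
      then obtain x where x: "x \<in> S" "x \<noteq> \<mu>" "dist x \<mu> < r"
        using r(1) unfolding islimpt_approachable by blast
      then show False using r(2)[of "x - \<mu>"] by (auto simp: S_def dist_norm not_less[symmetric])
    qed
  qed
  ultimately have "finite (S \<inter> S)" by (rule finite_not_islimpt_in_compact)
  then show ?thesis by (simp add: S_def)
qed

section \<open>Derivatives of f along lines\<close>

text \<open>The \<open>j\<close>-th derivative of \<open>\<lambda>t. f_fun \<alpha> J h (\<mu> + t *\<^sub>R y)\<close>.\<close>

definition f_line_deriv :: "('n::finite \<Rightarrow> real) \<Rightarrow> ('n \<Rightarrow> 'n \<Rightarrow> real) \<Rightarrow> ('n \<Rightarrow> real)
    \<Rightarrow> real^'n \<Rightarrow> nat \<Rightarrow> real^'n \<Rightarrow> real \<Rightarrow> real" where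
  "f_line_deriv \<alpha> J h \<mu> j y t =
     (if j = 0 then - (1/2) * ((\<mu> + t *\<^sub>R y) \<bullet> (block_matrix \<alpha> J *v (\<mu> + t *\<^sub>R y)))
      else if j = 1 then - ((\<mu> + t *\<^sub>R y) \<bullet> (block_matrix \<alpha> J *v y))
      else if j = 2 then - (y \<bullet> (block_matrix \<alpha> J *v y)) else 0)
     + (\<Sum>l\<in>UNIV. \<alpha> l * ((field_matrix \<alpha> J *v y) $ l ^ j *
          ln_cosh_deriv j ((field_matrix \<alpha> J *v \<mu>) $ l + h l + t * (field_matrix \<alpha> J *v y) $ l)))"

lemma f_line_deriv_0: "f_line_deriv \<alpha> J h \<mu> 0 y t = f_fun \<alpha> J h (\<mu> + t *\<^sub>R y)"
  by (simp add: f_line_deriv_def f_fun_eq ln_cosh_deriv_def matrix_vector_right_distrib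
      matrix_vector_mult_scaleR add_ac)

lemma DERIV_f_line_deriv:
  assumes "\<forall>l s. J l s = J s l"
  shows "(f_line_deriv \<alpha> J h \<mu> j y has_real_derivative f_line_deriv \<alpha> J h \<mu> (Suc j) y t) (at t)"
proof -
  let ?M = "block_matrix \<alpha> J"
  define Q where "Q = (\<lambda>(j::nat) t. if j = 0 then - (1/2) * ((\<mu> + t *\<^sub>R y) \<bullet> (?M *v (\<mu> + t *\<^sub>R y)))
      else if j = 1 then - ((\<mu> + t *\<^sub>R y) \<bullet> (?M *v y))
      else if j = 2 then - (y \<bullet> (?M *v y)) else 0)"
  \<comment> \<open>Symmetry of the matrix merges the two cross terms, which makes the quadratic
    part an explicit polynomial in t.\<close>
  have Q0: "Q 0 = (\<lambda>t. - (1/2) * (\<mu> \<bullet> (?M *v \<mu>) + 2 * t * (\<mu> \<bullet> (?M *v y)) + t\<^sup>2 * (y \<bullet> (?M *v y))))"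
    using block_matrix_symmetric[OF assms, of y \<alpha> \<mu>]
    by (simp add: Q_def fun_eq_iff matrix_vector_right_distrib matrix_vector_mult_scaleR
      inner_add_left inner_add_right power2_eq_square algebra_simps)
  have Q1: "Q (Suc 0) = (\<lambda>t. - (\<mu> \<bullet> (?M *v y) + t * (y \<bullet> (?M *v y))))"
    unfolding Q_def by (simp add: fun_eq_iff inner_add_left if_not_P)
  have "(Q j has_real_derivative Q (Suc j) t) (at t)"
  proof -
    consider "j = 0" | "j = 1" | "j \<ge> 2" by linarith
    then show ?thesis
    proof cases
      case 1
      show ?thesis unfolding 1 Q0 Q1
        by (auto intro!: derivative_eq_intros simp: algebra_simps)
    next
      case 2
      show ?thesis unfolding 2 One_nat_def Q1 by (auto intro!: derivative_eq_intros simp: Q_def)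
    next
      case 3
      then have "Q j = (\<lambda>t. Q j 0)" "Q (Suc j) t = 0" by (auto simp: Q_def)
      then show ?thesis by (metis DERIV_const)
    qed
  qed
  moreover have "((\<lambda>t. \<Sum>l\<in>UNIV. \<alpha> l * ((field_matrix \<alpha> J *v y) $ l ^ j *
          ln_cosh_deriv j ((field_matrix \<alpha> J *v \<mu>) $ l + h l + t * (field_matrix \<alpha> J *v y) $ l)))
      has_real_derivative (\<Sum>l\<in>UNIV. \<alpha> l * ((field_matrix \<alpha> J *v y) $ l ^ Suc j *
          ln_cosh_deriv (Suc j) ((field_matrix \<alpha> J *v \<mu>) $ l + h l + t * (field_matrix \<alpha> J *v y) $ l)))) (at t)"
    by (auto intro!: derivative_eq_intros DERIV_chain2[OF DERIV_ln_cosh_deriv] simp: mult_ac)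
  ultimately show ?thesis
    unfolding f_line_deriv_def[abs_def] Q_def by (rule DERIV_add)
qed

lemma continuous_on_f_line_deriv:
  "continuous_on UNIV (\<lambda>p. f_line_deriv \<alpha> J h \<mu> j (fst p) (snd p))"
proof -
  have "continuous_on UNIV (\<lambda>p. if j = 0 then - (1/2) * ((\<mu> + snd p *\<^sub>R fst p) \<bullet> (block_matrix \<alpha> J *v (\<mu> + snd p *\<^sub>R fst p)))
      else if j = 1 then - ((\<mu> + snd p *\<^sub>R fst p) \<bullet> (block_matrix \<alpha> J *v fst p))
      else if j = 2 then - (fst p \<bullet> (block_matrix \<alpha> J *v fst p)) else 0)"
    by (cases "j = 0"; cases "j = 1"; cases "j = 2")
       (auto intro!: continuous_intros continuous_on_compose2[OF linear_continuous_on[OF matrix_vector_mul_bounded_linear]])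
  then show ?thesis unfolding f_line_deriv_def
    by (intro continuous_on_add continuous_on_sum continuous_on_mult continuous_on_power continuous_on_const
       continuous_on_compose2[OF continuous_on_ln_cosh_deriv[of UNIV]] continuous_on_component
       continuous_on_compose2[OF linear_continuous_on[OF matrix_vector_mul_bounded_linear]] 
       continuous_on_fst continuous_on_snd continuous_on_id) auto
qed

lemma f_fun_expansion:
  assumes J: "\<forall>l s. J l s = J s l" and ht: "has_hom_type (f_fun \<alpha> J h) \<mu> k"
  shows "((\<lambda>t. (f_fun \<alpha> J h (\<mu> + t *\<^sub>R y) - f_fun \<alpha> J h \<mu>) / t ^ (2*k)) \<longlongrightarrow> taylor_term (f_fun \<alpha> J h) \<mu> (2*k) y) (at_right 0)"
    and "\<exists>r>0. \<exists>c>0. \<forall>y. norm y \<le> r \<longrightarrow> f_fun \<alpha> J h (\<mu> + y) - f_fun \<alpha> J h \<mu> \<le> - c * norm y ^ (2*k)"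
  by (rule has_hom_type_expansion[where D="f_line_deriv \<alpha> J h \<mu>",
        OF f_line_deriv_0 DERIV_f_line_deriv[OF J] continuous_on_f_line_deriv ht])+

section \<open>The Gibbs measure\<close>

lemma finite_config_space: "finite (config_space N)"
  unfolding config_space_def by (intro finite_PiE) auto

lemma config_space_nonempty: "config_space N \<noteq> {}"
  unfolding config_space_def by (auto simp: PiE_eq_empty_iff)

lemma block_partition_finite:
  assumes "is_block_partition \<alpha> N P"
  shows "finite (P l)"
  using assms unfolding is_block_partition_def by (metis UN_upper UNIV_I finite_atLeastAtMost finite_subset)

text \<open>The exponent is a sum over sites, with a coefficient depending only on the block, so the
  sum over configurations factorizes into \<open>2 * cosh (c l)\<close> for each site of block l;
  the block sizes then become the exponents.\<close>

lemma sum_config_space_exp: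
  fixes c :: "'n::finite \<Rightarrow> real"
  assumes P: "is_block_partition \<alpha> N P"
  shows "(\<Sum>\<sigma>\<in>config_space N. exp (\<Sum>l\<in>UNIV. c l * (\<Sum>i\<in>P l. \<sigma> i)))
     = 2 ^ N * exp (N * (\<Sum>l\<in>UNIV. \<alpha> l * ln (cosh (c l))))"
proof -
  have U: "(\<Union>l. P l) = {1..N}" and dj: "\<And>l s. l \<noteq> s \<Longrightarrow> P l \<inter> P s = {}"
    and card: "\<And>l. real (card (P l)) = \<alpha> l * N"
    using P unfolding is_block_partition_def by auto
  note fin = block_partition_finite[OF P]
  define b where "b = (\<lambda>i. THE l. i \<in> P l)"
  have b: "b i = l" if "i \<in> P l" for i l
    unfolding b_def using that dj by (intro the_equality) auto
  have prod_blocks: "(\<Prod>i\<in>{1..N}. f i) = (\<Prod>l\<in>UNIV. \<Prod>i\<in>P l. f i)" for f :: "nat \<Rightarrow> real"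
    unfolding U[symmetric] by (rule prod.UNION_disjoint) (use fin dj in auto)
  have blk: "(\<Prod>i\<in>P l. cosh (c (b i))) = exp (N * (\<alpha> l * ln (cosh (c l))))" for l
  proof -
    have "(\<Prod>i\<in>P l. cosh (c (b i))) = (\<Prod>i\<in>P l. exp (ln (cosh (c l))))"
      by (intro prod.cong) (auto simp: b)
    also have "\<dots> = exp (real (card (P l)) * ln (cosh (c l)))"
      by (simp add: exp_of_nat_mult)
    finally show ?thesis by (simp add: card mult_ac)
  qed
  have "exp (\<Sum>l\<in>UNIV. c l * (\<Sum>i\<in>P l. \<sigma> i)) = (\<Prod>i\<in>{1..N}. exp (c (b i) * \<sigma> i))" for \<sigma> :: "nat \<Rightarrow> real"
    unfolding prod_blocks by (simp add: exp_sum sum_distrib_left fin b)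
  then have "(\<Sum>\<sigma>\<in>config_space N. exp (\<Sum>l\<in>UNIV. c l * (\<Sum>i\<in>P l. \<sigma> i)))
      = (\<Prod>i\<in>{1..N}. \<Sum>t\<in>{-1, 1::real}. exp (c (b i) * t))"
    unfolding config_space_def by (subst prod_sum_PiE) auto
  also have "\<dots> = (\<Prod>i\<in>{1..N}. 2 * cosh (c (b i)))"
    by (intro prod.cong refl) (simp add: cosh_def field_simps)
  also have "\<dots> = 2 ^ N * (\<Prod>l\<in>UNIV. \<Prod>i\<in>P l. cosh (c (b i)))"
    unfolding prod.distrib prod_blocks[of "\<lambda>i. cosh (c (b i))"] by simp
  also have "\<dots> = 2 ^ N * (\<Prod>l\<in>UNIV. exp (N * (\<alpha> l * ln (cosh (c l)))))"
    unfolding blk ..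
  finally show ?thesis
    by (simp add: exp_sum[symmetric] sum_distrib_left)
qed

text \<open>Expanding the square, its term quadratic in the magnetization cancels the quadratic part
  of \<open>N * g_fun\<close>. What remains is linear in the spins, with coefficient
  \<open>c l\<close> in block l, and \<open>sum_config_space_exp\<close> applies. The identity holds
  for each x, before any integration.\<close>

lemma hubbard_stratonovich:
  assumes P: "is_block_partition \<alpha> N P" and N: "N \<ge> 1" and \<alpha>: "\<forall>l. 0 < \<alpha> l" and J: "\<forall>l s. J l s = J s l"
  shows "(\<Sum>\<sigma>\<in>config_space N. exp (N * g_fun \<alpha> J h (magnetization P \<sigma>))
        * exp (- (N / 2) * ((x - magnetization P \<sigma>) \<bullet> (block_matrix \<alpha> J *v (x - magnetization P \<sigma>)))))
     = 2 ^ N * exp (N * f_fun \<alpha> J h x)"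
proof -
  let ?M = "block_matrix \<alpha> J"
  define c where "c = (\<lambda>l. (field_matrix \<alpha> J *v x) $ l + h l)"
  have card: "\<And>l. real (card (P l)) = \<alpha> l * N"
    using P unfolding is_block_partition_def by auto
  have *: "N * g_fun \<alpha> J h m + (- (N / 2) * ((x - m) \<bullet> (?M *v (x - m))))
      = - (N / 2) * (x \<bullet> (?M *v x)) + (\<Sum>l\<in>UNIV. c l * (\<Sum>i\<in>P l. \<sigma> i))"
    if m: "m = magnetization P \<sigma>" for \<sigma> m
  proof -
    have "(\<Sum>l\<in>UNIV. c l * (\<Sum>i\<in>P l. \<sigma> i)) = (\<Sum>l\<in>UNIV. N * (m $ l * (?M *v x) $ l + \<alpha> l * h l * m $ l))"
    proof (rule sum.cong[OF refl])
      fix l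
      \<comment> \<open>Blocks are nonempty, so the division in \<open>magnetization\<close> is a
        genuine one and can be undone.\<close>
      have nz: "\<alpha> l * N \<noteq> 0" using \<alpha>[rule_format, of l] N by auto
      have "(\<Sum>i\<in>P l. \<sigma> i) = \<alpha> l * N * m $ l"
        unfolding m magnetization_def card using nz by simp
      then show "c l * (\<Sum>i\<in>P l. \<sigma> i) = N * (m $ l * (?M *v x) $ l + \<alpha> l * h l * m $ l)"
        by (simp add: c_def block_matrix_nth algebra_simps)
    qed
    also have "\<dots> = N * (m \<bullet> (?M *v x) + (\<Sum>l\<in>UNIV. \<alpha> l * h l * m $ l))"
      by (simp add: sum_distrib_left[symmetric] sum.distrib inner_vec_def)
    finally have 1: "(\<Sum>l\<in>UNIV. c l * (\<Sum>i\<in>P l. \<sigma> i)) = N * (m \<bullet> (?M *v x) + (\<Sum>l\<in>UNIV. \<alpha> l * h l * m $ l))" .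
    have 2: "(x - m) \<bullet> (?M *v (x - m)) = x \<bullet> (?M *v x) - 2 * (m \<bullet> (?M *v x)) + m \<bullet> (?M *v m)"
      using block_matrix_symmetric[OF J, of x \<alpha> m]
      by (simp add: matrix_vector_mult_diff_distrib inner_diff_left inner_diff_right)
    show ?thesis
      unfolding 1 2 g_fun_def quadratic_form_block_matrix by (simp add: algebra_simps)
  qed
  have "(\<Sum>\<sigma>\<in>config_space N. exp (N * g_fun \<alpha> J h (magnetization P \<sigma>))
        * exp (- (N / 2) * ((x - magnetization P \<sigma>) \<bullet> (?M *v (x - magnetization P \<sigma>)))))
      = (\<Sum>\<sigma>\<in>config_space N. exp (- (N / 2) * (x \<bullet> (?M *v x))) * exp (\<Sum>l\<in>UNIV. c l * (\<Sum>i\<in>P l. \<sigma> i)))"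
    by (intro sum.cong refl) (simp only: exp_add[symmetric] *[OF refl])
  also have "\<dots> = exp (- (N / 2) * (x \<bullet> (?M *v x))) * (2 ^ N * exp (N * (\<Sum>l\<in>UNIV. \<alpha> l * ln (cosh (c l)))))"
    unfolding sum_distrib_left[symmetric] sum_config_space_exp[OF P] ..
  also have "\<dots> = 2 ^ N * exp (N * f_fun \<alpha> J h x)"
    by (simp add: f_fun_eq c_def exp_add[symmetric] algebra_simps)
  finally show ?thesis .
qed

text \<open>Serves both the Gibbs measure and the limiting mixture of point masses: each is a
  normalized family of weights on a finite set.\<close>

lemma expectation_embed_pmf_finite:
  fixes w :: "'a \<Rightarrow> real" and \<phi> :: "'a \<Rightarrow> real"
  assumes S: "finite S" and w: "\<And>x. x \<in> S \<Longrightarrow> 0 \<le> w x" "(\<Sum>x\<in>S. w x) > 0"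
  shows "measure_pmf.expectation (embed_pmf (\<lambda>x. if x \<in> S then w x / (\<Sum>y\<in>S. w y) else 0)) \<phi>
     = (\<Sum>x\<in>S. \<phi> x * w x) / (\<Sum>x\<in>S. w x)"
proof -
  define W where "W = (\<Sum>y\<in>S. w y)"
  define p where "p = (\<lambda>x. if x \<in> S then w x / W else 0)"
  have nn: "0 \<le> p x" for x using w by (simp add: p_def W_def)
  have "(\<integral>\<^sup>+x. ennreal (p x) \<partial>count_space UNIV) = (\<Sum>x\<in>S. ennreal (p x))"
    by (rule nn_integral_count_space') (auto simp: S p_def)
  also have "\<dots> = ennreal (\<Sum>x\<in>S. p x)" using nn by (simp add: sum_ennreal)
  also have "(\<Sum>x\<in>S. p x) = 1"
    using w(2) by (simp add: p_def sum_divide_distrib[symmetric] W_def)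
  finally have pmf: "pmf (embed_pmf p) x = p x" for x
    by (intro pmf_embed_pmf nn) simp
  have "measure_pmf.expectation (embed_pmf p) \<phi> = (\<Sum>x\<in>S. \<phi> x * pmf (embed_pmf p) x)"
  proof (rule integral_measure_pmf_real[OF S])
    fix x assume "x \<in> set_pmf (embed_pmf p)"
    then show "x \<in> S" by (rule contrapos_pp) (simp add: set_pmf_eq pmf, simp add: p_def)
  qed
  also have "\<dots> = (\<Sum>x\<in>S. \<phi> x * p x)" by (simp only: pmf)
  also have "\<dots> = (\<Sum>x\<in>S. \<phi> x * w x) / W"
    by (simp add: p_def sum_divide_distrib)
  finally show ?thesis unfolding p_def W_def .
qed

section \<open>Gibbs expectations and their smoothed versions\<close>

definition gibbs_weight :: "('n::finite \<Rightarrow> real) \<Rightarrow> ('n \<Rightarrow> 'n \<Rightarrow> real) \<Rightarrow> ('n \<Rightarrow> real)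
    \<Rightarrow> nat \<Rightarrow> ('n \<Rightarrow> nat set) \<Rightarrow> (nat \<Rightarrow> real) \<Rightarrow> real" where
  "gibbs_weight \<alpha> J h N P \<sigma> = exp (real N * g_fun \<alpha> J h (magnetization P \<sigma>))"

lemma sum_gibbs_weight_pos: "(\<Sum>\<sigma>\<in>config_space N. gibbs_weight \<alpha> J h N P \<sigma>) > 0"
  using finite_config_space config_space_nonempty by (intro sum_pos) (auto simp: gibbs_weight_def)

lemma expectation_magnetization_law:
  fixes \<phi> :: "real^'n::finite \<Rightarrow> real"
  shows "measure_pmf.expectation (magnetization_law \<alpha> J h N P) \<phi>
     = (\<Sum>\<sigma>\<in>config_space N. \<phi> (magnetization P \<sigma>) * gibbs_weight \<alpha> J h N P \<sigma>)
       / (\<Sum>\<sigma>\<in>config_space N. gibbs_weight \<alpha> J h N P \<sigma>)"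
  unfolding magnetization_law_def integral_map_pmf gibbs_pmf_def gibbs_weight_def[symmetric]
  by (rule expectation_embed_pmf_finite[OF finite_config_space _ sum_gibbs_weight_pos])
     (simp add: gibbs_weight_def)

text \<open>The crude bound by the sum of the coordinates is enough: the radius has only to be the
  same for all N, partitions and configurations.\<close>

lemma magnetization_bounded:
  fixes P :: "'n::finite \<Rightarrow> nat set"
  assumes P: "is_block_partition \<alpha> N P" and "\<sigma> \<in> config_space N"
  shows "norm (magnetization P \<sigma>) \<le> CARD('n)"
proof -
  have "\<bar>magnetization P \<sigma> $ l\<bar> \<le> 1" for l
  proof -
    have "P l \<subseteq> {1..N}" using P unfolding is_block_partition_def by blast
    then have "\<bar>\<sigma> i\<bar> \<le> 1" if "i \<in> P l" for i
      using assms(2) that unfolding config_space_def PiE_iff by (metis abs_minus_cancel abs_one empty_iff insert_iff order_refl subsetD)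
    then have "\<bar>\<Sum>i\<in>P l. \<sigma> i\<bar> \<le> (\<Sum>i\<in>P l. 1)"
      by (intro order_trans[OF sum_abs] sum_mono)
    then have "\<bar>\<Sum>i\<in>P l. \<sigma> i\<bar> \<le> card (P l)" by simp
    then show ?thesis unfolding magnetization_def by (simp add: divide_simps)
  qed
  then have "(\<Sum>l\<in>UNIV. \<bar>magnetization P \<sigma> $ l\<bar>) \<le> (\<Sum>l\<in>(UNIV::'n set). 1)"
    by (intro sum_mono)
  then show ?thesis using norm_le_l1_cart[of "magnetization P \<sigma>"] by simp
qed

text \<open>The identity \<open>hubbard_stratonovich\<close> integrated against
  \<open>\<phi>\<close>. Centring each Gaussian at its magnetization and rescaling by
  \<open>1 / sqrt N\<close> turns it into noise of fixed shape and shrinking amplitude, at the price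
  of the factor \<open>sqrt N ^ CARD('n)\<close>.\<close>

lemma smoothed_magnetization:
  fixes \<phi> :: "real^'n::finite \<Rightarrow> real"
  assumes P: "is_block_partition \<alpha> N P" and N: "N \<ge> 1" and \<alpha>: "\<forall>l. 0 < \<alpha> l" and J: "\<forall>l s. J l s = J s l"
    and \<phi>: "continuous_on UNIV \<phi>" "\<And>x. \<bar>\<phi> x\<bar> \<le> B"
    and M: "a > 0" "\<And>x. a * (norm x)\<^sup>2 \<le> x \<bullet> (block_matrix \<alpha> J *v x)"
  shows "(\<Sum>\<sigma>\<in>config_space N. gibbs_weight \<alpha> J h N P \<sigma> *
       (\<integral>y. \<phi> (magnetization P \<sigma> + (1 / sqrt N) *\<^sub>R y) * exp (- (1/2) * (y \<bullet> (block_matrix \<alpha> J *v y))) \<partial>lborel))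
     = sqrt N ^ CARD('n) * 2 ^ N * (\<integral>x. \<phi> x * exp (N * f_fun \<alpha> J h x) \<partial>lborel)"
proof -
  let ?M = "block_matrix \<alpha> J"
  have [measurable]: "\<phi> \<in> borel_measurable borel" by (rule borel_measurable_continuous_onI[OF \<phi>(1)])
  have [measurable]: "(\<lambda>x. x \<bullet> (?M *v x)) \<in> borel_measurable borel"
    by (intro borel_measurable_continuous_onI continuous_intros)
  have sN: "sqrt N > 0" using N by simp
  define G where "G = (\<lambda>\<sigma> x. \<phi> x * exp (- (N / 2) * ((x - magnetization P \<sigma>) \<bullet> (?M *v (x - magnetization P \<sigma>)))))"
  have [measurable]: "G \<sigma> \<in> borel_measurable borel" for \<sigma>
  proof -
    have "(\<lambda>x. (x - magnetization P \<sigma>) \<bullet> (?M *v (x - magnetization P \<sigma>))) \<in> borel_measurable borel"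
      by (intro borel_measurable_continuous_onI continuous_intros bounded_linear.continuous_on[OF matrix_vector_mul_bounded_linear])
    then show ?thesis unfolding G_def by measurable
  qed
  have B0: "B \<ge> 0" using \<phi>(2)[of 0] by linarith
  have intG0: "integrable lborel (\<lambda>y. G \<sigma> (magnetization P \<sigma> + y))" for \<sigma>
  proof (rule Bochner_Integration.integrable_bound[where f="\<lambda>y. B * exp (- (N / 2 * a) * (norm y)\<^sup>2)"])
    show "integrable lborel (\<lambda>y::real^'n. B * exp (- (N / 2 * a) * (norm y)\<^sup>2))"
      using integrable_gaussian[of "N / 2 * a", where 'a="real^'n"] N M(1) by simp
    show "AE y in lborel. norm (G \<sigma> (magnetization P \<sigma> + y)) \<le> norm (B * exp (- (N / 2 * a) * (norm y)\<^sup>2))"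
    proof (rule AE_I2)
      fix y
      have "N / 2 * (a * (norm y)\<^sup>2) \<le> N / 2 * (y \<bullet> (?M *v y))"
        by (intro mult_left_mono M(2)) simp
      then show "norm (G \<sigma> (magnetization P \<sigma> + y)) \<le> norm (B * exp (- (N / 2 * a) * (norm y)\<^sup>2))"
        unfolding G_def using \<phi>(2) B0 by (auto simp: abs_mult mult.assoc intro!: mult_mono)
    qed
  qed measurable
  have intG: "integrable lborel (G \<sigma>)" for \<sigma>
  proof -
    have "integrable (distr lborel borel (\<lambda>x. magnetization P \<sigma> + x)) (G \<sigma>)"
      by (subst integrable_distr_eq) (use intG0 in auto)
    then show ?thesis by (simp add: lborel_distr_plus)
  qed
  have scale: "(\<integral>y. \<phi> (magnetization P \<sigma> + (1 / sqrt N) *\<^sub>R y) * exp (- (1/2) * (y \<bullet> (?M *v y))) \<partial>lborel)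
      = sqrt N ^ CARD('n) * (\<integral>x. G \<sigma> x \<partial>lborel)" for \<sigma>
  proof -
    have "G \<sigma> (magnetization P \<sigma> + (1 / sqrt N) *\<^sub>R y)
        = \<phi> (magnetization P \<sigma> + (1 / sqrt N) *\<^sub>R y) * exp (- (1/2) * (y \<bullet> (?M *v y)))" for y
      using N by (simp add: G_def matrix_vector_mult_scaleR field_simps)
    then have "(\<integral>x. G \<sigma> x \<partial>lborel) = (1 / sqrt N) ^ CARD('n) *
        (\<integral>y. \<phi> (magnetization P \<sigma> + (1 / sqrt N) *\<^sub>R y) * exp (- (1/2) * (y \<bullet> (?M *v y))) \<partial>lborel)"
      using sN by (subst lborel_integral_affine[where c="1 / sqrt N" and t="magnetization P \<sigma>"]) auto
    then show ?thesis using sN by (simp add: power_divide)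
  qed
  have mix: "(\<Sum>\<sigma>\<in>config_space N. gibbs_weight \<alpha> J h N P \<sigma> * G \<sigma> x) = 2 ^ N * (\<phi> x * exp (N * f_fun \<alpha> J h x))" for x
  proof -
    have "(\<Sum>\<sigma>\<in>config_space N. gibbs_weight \<alpha> J h N P \<sigma> * G \<sigma> x) = \<phi> x * (2 ^ N * exp (N * f_fun \<alpha> J h x))"
      unfolding hubbard_stratonovich[OF P N \<alpha> J, of h x, symmetric] sum_distrib_left
      by (intro sum.cong refl) (simp add: G_def gibbs_weight_def)
    then show ?thesis by simp
  qed
  have "(\<Sum>\<sigma>\<in>config_space N. gibbs_weight \<alpha> J h N P \<sigma> * (\<integral>x. G \<sigma> x \<partial>lborel))
      = (\<integral>x. (\<Sum>\<sigma>\<in>config_space N. gibbs_weight \<alpha> J h N P \<sigma> * G \<sigma> x) \<partial>lborel)"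
    using intG by (simp add: Bochner_Integration.integral_sum)
  also have "\<dots> = 2 ^ N * (\<integral>x. \<phi> x * exp (N * f_fun \<alpha> J h x) \<partial>lborel)"
    unfolding mix by simp
  finally have "(\<Sum>\<sigma>\<in>config_space N. gibbs_weight \<alpha> J h N P \<sigma> * (\<integral>x. G \<sigma> x \<partial>lborel)) = \<dots>" .
  moreover have "(\<Sum>\<sigma>\<in>config_space N. gibbs_weight \<alpha> J h N P \<sigma> *
       (\<integral>y. \<phi> (magnetization P \<sigma> + (1 / sqrt N) *\<^sub>R y) * exp (- (1/2) * (y \<bullet> (?M *v y))) \<partial>lborel))
     = sqrt N ^ CARD('n) * (\<Sum>\<sigma>\<in>config_space N. gibbs_weight \<alpha> J h N P \<sigma> * (\<integral>x. G \<sigma> x \<partial>lborel))"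
    unfolding scale sum_distrib_left by (intro sum.cong refl mult.left_commute)
  ultimately show ?thesis
    by (simp only: mult.assoc)
qed

section \<open>Removing the Gaussian noise\<close>

lemma integral_exp_pos:
  fixes T :: "'a::euclidean_space \<Rightarrow> real"
  assumes "integrable lborel (\<lambda>x. exp (T x))"
  shows "0 < (\<integral>x. exp (T x) \<partial>lborel)"
proof -
  \<comment> \<open>A vanishing integral would force a positive integrand to be 0 almost everywhere,
    although the space is not a null set. Integrability is essential, the Bochner integral of a
    non-integrable function being 0 by default.\<close>
  have "(\<integral>x. exp (T x) \<partial>lborel) \<noteq> 0"
  proof
    assume "(\<integral>x. exp (T x) \<partial>lborel) = 0"
    then have "AE x in lborel. exp (T x) = 0"
      by (subst (asm) integral_nonneg_eq_0_iff_AE[OF assms]) auto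
    then have "AE x::'a in lborel. False" by simp
    then show False
      using AE_iff_null_sets[of UNIV "lborel :: 'a measure"] by (simp add: null_sets_def emeasure_lborel_UNIV)
  qed
  moreover have "0 \<le> (\<integral>x. exp (T x) \<partial>lborel)" by simp
  ultimately show ?thesis by linarith
qed

text \<open>The difference is the integral of \<open>\<gamma>\<close> against a weighted average of
  increments of \<open>\<phi>\<close>. Weights and index sets vary with i, so the increments must be
  small uniformly in \<open>\<sigma>\<close>; for fixed y this holds because all base points lie in
  one ball. Dominated convergence then integrates over y.\<close>

lemma smoothing_error_tendsto_0:
  fixes \<phi> :: "real^'n::finite \<Rightarrow> real" and \<gamma> :: "real^'n \<Rightarrow> real" and m :: "nat \<Rightarrow> 'b \<Rightarrow> real^'n"
  assumes \<phi>: "continuous_on UNIV \<phi>" "\<And>x. \<bar>\<phi> x\<bar> \<le> B"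
    and \<gamma>: "integrable lborel \<gamma>" "\<And>y. \<gamma> y \<ge> 0"
    and w: "\<And>i. finite (A i)" "\<And>i \<sigma>. \<sigma> \<in> A i \<Longrightarrow> 0 \<le> w i \<sigma>" "\<And>i. (\<Sum>\<sigma>\<in>A i. w i \<sigma>) > 0"
    and m: "\<And>i \<sigma>. \<sigma> \<in> A i \<Longrightarrow> norm (m i \<sigma>) \<le> R"
    and s: "s \<longlonglongrightarrow> 0"
  shows "(\<lambda>i. (\<Sum>\<sigma>\<in>A i. w i \<sigma> * (\<integral>y. \<phi> (m i \<sigma> + s i *\<^sub>R y) * \<gamma> y \<partial>lborel)) / (\<Sum>\<sigma>\<in>A i. w i \<sigma>)
      - (\<Sum>\<sigma>\<in>A i. \<phi> (m i \<sigma>) * w i \<sigma>) / (\<Sum>\<sigma>\<in>A i. w i \<sigma>) * (\<integral>y. \<gamma> y \<partial>lborel)) \<longlonglongrightarrow> 0"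
proof -
  define W where "W = (\<lambda>i. \<Sum>\<sigma>\<in>A i. w i \<sigma>)"
  have W: "W i > 0" for i using w(3) by (simp add: W_def)
  have [measurable]: "\<phi> \<in> borel_measurable borel" by (rule borel_measurable_continuous_onI[OF \<phi>(1)])
  have [measurable]: "\<gamma> \<in> borel_measurable borel" using borel_measurable_integrable[OF \<gamma>(1)] by simp
  have int: "integrable lborel (\<lambda>y. \<phi> (z + t *\<^sub>R y) * \<gamma> y)" for z t
  proof (rule Bochner_Integration.integrable_bound[where f="\<lambda>y. B * \<gamma> y"])
    show "AE y in lborel. norm (\<phi> (z + t *\<^sub>R y) * \<gamma> y) \<le> norm (B * \<gamma> y)"
      using \<phi>(2) \<gamma>(2) by (intro AE_I2) (auto simp: abs_mult intro!: mult_right_mono order_trans[OF _ abs_ge_self])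
  qed (use \<gamma> in auto)
  \<comment> \<open>The average over the weights is taken inside the integral, so that convergence
    is needed only for one function of y per index i.\<close>
  define D where "D = (\<lambda>i y. (\<Sum>\<sigma>\<in>A i. w i \<sigma> * (\<phi> (m i \<sigma> + s i *\<^sub>R y) - \<phi> (m i \<sigma>))) / W i)"
  have abs_avg: "\<bar>D i y\<bar> \<le> e" if "\<And>\<sigma>. \<sigma> \<in> A i \<Longrightarrow> \<bar>\<phi> (m i \<sigma> + s i *\<^sub>R y) - \<phi> (m i \<sigma>)\<bar> \<le> e" for i y e
  proof -
    have "\<bar>\<Sum>\<sigma>\<in>A i. w i \<sigma> * (\<phi> (m i \<sigma> + s i *\<^sub>R y) - \<phi> (m i \<sigma>))\<bar> \<le> (\<Sum>\<sigma>\<in>A i. w i \<sigma> * e)"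
      using that w(2) by (intro order_trans[OF sum_abs] sum_mono) (auto simp: abs_mult intro!: mult_left_mono)
    also have "\<dots> = W i * e" by (simp add: W_def sum_distrib_right)
    finally show ?thesis using W[of i] by (simp add: D_def field_simps)
  qed
  have eq: "(\<Sum>\<sigma>\<in>A i. w i \<sigma> * (\<integral>y. \<phi> (m i \<sigma> + s i *\<^sub>R y) * \<gamma> y \<partial>lborel)) / W i
      - (\<Sum>\<sigma>\<in>A i. \<phi> (m i \<sigma>) * w i \<sigma>) / W i * (\<integral>y. \<gamma> y \<partial>lborel) = (\<integral>y. D i y * \<gamma> y \<partial>lborel)" for i
  proof -
    have "D i y * \<gamma> y = (\<Sum>\<sigma>\<in>A i. w i \<sigma> / W i * (\<phi> (m i \<sigma> + s i *\<^sub>R y) * \<gamma> y - \<phi> (m i \<sigma>) * \<gamma> y))" for y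
      unfolding D_def sum_divide_distrib sum_distrib_right
      by (intro sum.cong refl) (simp add: algebra_simps diff_divide_distrib)
    then have "(\<integral>y. D i y * \<gamma> y \<partial>lborel)
        = (\<Sum>\<sigma>\<in>A i. w i \<sigma> / W i * ((\<integral>y. \<phi> (m i \<sigma> + s i *\<^sub>R y) * \<gamma> y \<partial>lborel) - \<phi> (m i \<sigma>) * (\<integral>y. \<gamma> y \<partial>lborel)))"
      using int \<gamma>(1) by (simp add: Bochner_Integration.integral_sum)
    then show ?thesis
      by (simp add: sum_divide_distrib sum_distrib_left right_diff_distrib sum_subtractf mult_ac)
  qed
  have "(\<lambda>i. \<integral>y. D i y * \<gamma> y \<partial>lborel) \<longlonglongrightarrow> (\<integral>y. 0 \<partial>(lborel :: (real^'n) measure))"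
  proof (rule integral_dominated_convergence[where w="\<lambda>y. 2 * B * \<gamma> y"])
    show "integrable lborel (\<lambda>y. 2 * B * \<gamma> y)" using \<gamma>(1) by simp
    show "AE y in lborel. norm (D i y * \<gamma> y) \<le> 2 * B * \<gamma> y" for i
    proof (rule AE_I2)
      fix y
      have "\<bar>D i y\<bar> \<le> 2 * B"
      proof (rule abs_avg)
        fix \<sigma>
        show "\<bar>\<phi> (m i \<sigma> + s i *\<^sub>R y) - \<phi> (m i \<sigma>)\<bar> \<le> 2 * B"
          using \<phi>(2)[of "m i \<sigma> + s i *\<^sub>R y"] \<phi>(2)[of "m i \<sigma>"] by linarith
      qed
      then show "norm (D i y * \<gamma> y) \<le> 2 * B * \<gamma> y"
        using \<gamma>(2)[of y] by (auto simp: abs_mult intro!: mult_right_mono)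
    qed
    show "AE y in lborel. (\<lambda>i. D i y * \<gamma> y) \<longlonglongrightarrow> 0"
    proof (rule AE_I2)
      fix y
      have "(\<lambda>i. D i y) \<longlonglongrightarrow> 0"
      proof (rule LIMSEQ_I)
        fix e :: real assume e: "e > 0"
        \<comment> \<open>The extra 1 leaves room for the displacement
          \<open>s i *\<^sub>R y\<close>, which is eventually shorter than 1.\<close>
        have "uniformly_continuous_on (cball 0 (R + 1)) \<phi>"
          by (intro compact_uniformly_continuous continuous_on_subset[OF \<phi>(1)]) auto
        then obtain d where d: "d > 0" "\<And>x x'. x \<in> cball 0 (R + 1) \<Longrightarrow> x' \<in> cball 0 (R + 1) \<Longrightarrow> dist x' x < d \<Longrightarrow> dist (\<phi> x') (\<phi> x) < e / 2"
          using e unfolding uniformly_continuous_on_def by (metis half_gt_zero)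
        have "(\<lambda>i. norm (s i *\<^sub>R y)) \<longlonglongrightarrow> norm (0 *\<^sub>R y)" by (intro tendsto_intros s)
        then have "\<forall>\<^sub>F i in sequentially. norm (s i *\<^sub>R y) < min 1 d"
          by (rule order_tendstoD(2)) (use d(1) in auto)
        then have "\<forall>\<^sub>F i in sequentially. norm (D i y - 0) < e"
        proof eventually_elim
          case (elim i)
          have "\<bar>D i y\<bar> \<le> e / 2"
          proof (rule abs_avg)
            fix \<sigma> assume "\<sigma> \<in> A i"
            then have mR: "norm (m i \<sigma>) \<le> R" by (rule m)
            have "norm (m i \<sigma> + s i *\<^sub>R y) \<le> R + 1"
              using elim mR norm_triangle_ineq[of "m i \<sigma>" "s i *\<^sub>R y"] by linarith
            moreover have "dist (m i \<sigma> + s i *\<^sub>R y) (m i \<sigma>) = norm (s i *\<^sub>R y)"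
              by (simp add: dist_norm)
            ultimately have "dist (\<phi> (m i \<sigma> + s i *\<^sub>R y)) (\<phi> (m i \<sigma>)) < e / 2"
              using elim mR by (intro d(2)) auto
            then show "\<bar>\<phi> (m i \<sigma> + s i *\<^sub>R y) - \<phi> (m i \<sigma>)\<bar> \<le> e / 2" by (simp add: dist_real_def)
          qed
          then show ?case using e by simp
        qed
        then show "\<exists>no. \<forall>n\<ge>no. norm (D n y - 0) < e" by (simp add: eventually_sequentially)
      qed
      then show "(\<lambda>i. D i y * \<gamma> y) \<longlonglongrightarrow> 0" by (rule tendsto_mult_left_zero)
    qed
    show "(\<lambda>y. D i y * \<gamma> y) \<in> borel_measurable lborel" for i
      unfolding D_def by measurable
  qed simp
  moreover have "(\<Sum>\<sigma>\<in>A i. w i \<sigma>) = W i" for i by (simp add: W_def)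
  ultimately show ?thesis by (simp only: eq) simp
qed

text \<open>Applying \<open>smoothed_magnetization\<close> to \<open>\<phi>\<close> and to the
  constant 1 gives the same prefactor, which cancels in the ratio. The ratio is thus the expectation
  of \<open>\<phi>\<close> under the magnetization law smoothed by normalized noise, and the
  previous estimate compares it with the unsmoothed one.\<close>

lemma expectation_minus_smoothed_tendsto_0:
  fixes \<alpha> :: "'n::finite \<Rightarrow> real" and \<phi> :: "real^'n \<Rightarrow> real"
  assumes \<alpha>: "\<forall>l. 0 < \<alpha> l" and J: "\<forall>l s. J l s = J s l"
    and pd: "\<forall>x :: 'n \<Rightarrow> real. x \<noteq> (\<lambda>_. 0) \<longrightarrow> (\<Sum>l\<in>UNIV. \<Sum>s\<in>UNIV. J l s * x l * x s) > 0"
    and \<phi>: "continuous_on UNIV \<phi>" "\<And>x. \<bar>\<phi> x\<bar> \<le> B"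
    and Ns: "filterlim Ns at_top sequentially" "\<And>i. Ns i \<ge> 1" and P: "\<And>i. is_block_partition \<alpha> (Ns i) (Ps i)"
  shows "(\<lambda>i. (\<integral>x. \<phi> x * exp (Ns i * f_fun \<alpha> J h x) \<partial>lborel) / (\<integral>x. exp (Ns i * f_fun \<alpha> J h x) \<partial>lborel)
      - measure_pmf.expectation (magnetization_law \<alpha> J h (Ns i) (Ps i)) \<phi>) \<longlonglongrightarrow> 0"
proof -
  obtain a where a: "a > 0" "\<And>x. a * (norm x)\<^sup>2 \<le> x \<bullet> (block_matrix \<alpha> J *v x)"
    using block_matrix_coercive[OF \<alpha> pd] by blast
  define \<gamma> where "\<gamma> = (\<lambda>y. exp (- (1/2) * (y \<bullet> (block_matrix \<alpha> J *v y))))"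
  define C where "C = (\<integral>y. \<gamma> y \<partial>lborel)"
  have \<gamma>: "integrable lborel \<gamma>"
  proof (rule Bochner_Integration.integrable_bound[where f="\<lambda>y. exp (- (a / 2) * (norm y)\<^sup>2)"])
    show "integrable lborel (\<lambda>y::real^'n. exp (- (a / 2) * (norm y)\<^sup>2))"
      using a(1) by (intro integrable_gaussian) simp
    show "\<gamma> \<in> borel_measurable lborel"
    proof -
      have "(\<lambda>y. y \<bullet> (block_matrix \<alpha> J *v y)) \<in> borel_measurable borel"
        by (intro borel_measurable_continuous_onI continuous_intros)
      then show ?thesis unfolding \<gamma>_def by measurable
    qed
    show "AE y in lborel. norm (\<gamma> y) \<le> norm (exp (- (a / 2) * (norm y)\<^sup>2))"
      using a(2) by (intro AE_I2) (simp add: \<gamma>_def)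
  qed
  have C: "C > 0" using integral_exp_pos[OF \<gamma>[unfolded \<gamma>_def]] by (simp add: C_def \<gamma>_def)
  let ?w = "\<lambda>i. gibbs_weight \<alpha> J h (Ns i) (Ps i)"
  let ?W = "\<lambda>i. \<Sum>\<sigma>\<in>config_space (Ns i). ?w i \<sigma>"
  define S where "S = (\<lambda>i. \<Sum>\<sigma>\<in>config_space (Ns i). ?w i \<sigma> * (\<integral>y. \<phi> (magnetization (Ps i) \<sigma> + (1 / sqrt (Ns i)) *\<^sub>R y) * \<gamma> y \<partial>lborel))"
  have Nr: "filterlim (\<lambda>i. sqrt (real (Ns i))) at_top sequentially"
    by (intro filterlim_compose[OF sqrt_at_top] filterlim_compose[OF filterlim_real_sequentially Ns(1)])
  have "(\<lambda>i. S i / ?W i - (\<Sum>\<sigma>\<in>config_space (Ns i). \<phi> (magnetization (Ps i) \<sigma>) * ?w i \<sigma>) / ?W i * C) \<longlonglongrightarrow> 0"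
    unfolding S_def C_def
  proof (rule smoothing_error_tendsto_0[OF \<phi> \<gamma>])
    show "(\<lambda>i. 1 / sqrt (real (Ns i))) \<longlonglongrightarrow> 0"
      using tendsto_divide_0[OF tendsto_const filterlim_at_top_imp_at_infinity[OF Nr]] .
    show "norm (magnetization (Ps i) \<sigma>) \<le> real CARD('n)" if "\<sigma> \<in> config_space (Ns i)" for i \<sigma>
      by (rule magnetization_bounded[OF P that])
  qed (auto simp: finite_config_space sum_gibbs_weight_pos, auto simp: gibbs_weight_def \<gamma>_def)
  then have lim: "(\<lambda>i. (S i / ?W i - (\<Sum>\<sigma>\<in>config_space (Ns i). \<phi> (magnetization (Ps i) \<sigma>) * ?w i \<sigma>) / ?W i * C) / C) \<longlonglongrightarrow> 0 / C"
    using C by (intro tendsto_divide tendsto_const) auto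
  have "(\<integral>x. \<phi> x * exp (Ns i * f_fun \<alpha> J h x) \<partial>lborel) / (\<integral>x. exp (Ns i * f_fun \<alpha> J h x) \<partial>lborel) = S i / (?W i * C)" for i
  proof -
    define K where "K = sqrt (Ns i) ^ CARD('n) * 2 ^ Ns i"
    have K: "K > 0" using Ns(2)[of i] by (simp add: K_def)
    have "S i = K * (\<integral>x. \<phi> x * exp (Ns i * f_fun \<alpha> J h x) \<partial>lborel)"
      unfolding S_def \<gamma>_def K_def by (rule smoothed_magnetization[OF P Ns(2) \<alpha> J \<phi> a])
    moreover have "?W i * C = K * (\<integral>x. exp (Ns i * f_fun \<alpha> J h x) \<partial>lborel)"
      using smoothed_magnetization[OF P[of i] Ns(2)[of i] \<alpha> J _ _ a, where \<phi>="\<lambda>_. 1" and B=1 and h=h]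
      by (simp add: C_def \<gamma>_def K_def sum_distrib_right)
    ultimately show ?thesis using K by simp
  qed
  with lim C show ?thesis
    by (simp add: expectation_magnetization_law diff_divide_distrib)
qed

lemma b_weight_eq:
  fixes \<alpha> :: "'n::finite \<Rightarrow> real"
  assumes \<alpha>: "\<forall>l. 0 < \<alpha> l" and int: "integrable lborel (\<lambda>y. exp (taylor_term F \<mu> (2*k) y))"
  shows "b_weight \<alpha> F k \<mu> = (\<Prod>l\<in>UNIV. \<alpha> l powr (1 / real (2*k))) * (\<integral>y. exp (taylor_term F \<mu> (2*k) y) \<partial>lborel)"
proof -
  define c where "c = (\<lambda>l. 1 / \<alpha> l powr (1 / real (2*k)))"
  have c: "c l > 0" for l using \<alpha>[rule_format, of l] by (simp add: c_def)
  have "(\<integral>y. exp (taylor_term F \<mu> (2*k) y) \<partial>lborel) = (\<Prod>l\<in>UNIV. c l) * b_weight \<alpha> F k \<mu>"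
    unfolding b_weight_def
    using lborel_integral_diagonal[OF _ c, of "\<lambda>y. exp (taylor_term F \<mu> (2*k) y)"] borel_measurable_integrable[OF int]
    by (simp add: c_def)
  moreover have "(\<Prod>l\<in>UNIV. \<alpha> l powr (1 / real (2*k))) * (\<Prod>l\<in>UNIV. c l) = 1"
    using c by (simp add: c_def prod.distrib[symmetric] less_imp_neq[symmetric])
  ultimately show ?thesis by (simp add: mult.assoc[symmetric])
qed

section \<open>Weak convergence of the magnetization\<close>

theorem mainTheorem12:
  fixes \<alpha> :: "'n::finite \<Rightarrow> real" and J :: "'n \<Rightarrow> 'n \<Rightarrow> real" and h :: "'n \<Rightarrow> real"
  assumes alpha_pos: "\<forall>l. 0 < \<alpha> l \<and> \<alpha> l < 1"
    and alpha_sum: "(\<Sum>l\<in>UNIV. \<alpha> l) = 1"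
    and J_sym: "\<forall>l s. J l s = J s l"
    and J_diag: "\<forall>l. J l l > 0"
    and J_posdef: "\<forall>x :: 'n \<Rightarrow> real. x \<noteq> (\<lambda>_. 0) \<longrightarrow> (\<Sum>l\<in>UNIV. \<Sum>s\<in>UNIV. J l s * x l * x s) > 0"
    and all_types: "\<forall>\<mu>\<in>global_max_points (f_fun \<alpha> J h). \<exists>k. has_hom_type (f_fun \<alpha> J h) \<mu> k"
  shows "\<forall>(Ns :: nat \<Rightarrow> nat) (Ps :: nat \<Rightarrow> 'n \<Rightarrow> nat set).
           filterlim Ns at_top sequentially \<and> (\<forall>i. is_block_partition \<alpha> (Ns i) (Ps i)) \<longrightarrow>
           weak_conv_pmf (\<lambda>i. magnetization_law \<alpha> J h (Ns i) (Ps i))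
             (weighted_dirac_mixture
                {\<mu>\<in>global_max_points (f_fun \<alpha> J h).
                   has_hom_type (f_fun \<alpha> J h) \<mu> (max_hom_type (f_fun \<alpha> J h))}
                (b_weight \<alpha> (f_fun \<alpha> J h) (max_hom_type (f_fun \<alpha> J h))))"
proof -
  define f where "f = f_fun \<alpha> J h"
  define S where "S = global_max_points f"
  define kk where "kk = hom_type f"
  define K where "K = max_hom_type f"
  define T where "T = (\<lambda>\<mu>. taylor_term f \<mu> (2 * kk \<mu>))"
  define S' where "S' = {\<mu>\<in>S. kk \<mu> = K}"
  have \<alpha>: "\<forall>l. 0 < \<alpha> l" using alpha_pos by blast
  obtain a C where a: "a > 0" "\<And>x. f x \<le> C - a * (norm x)\<^sup>2"
    using f_fun_coercive[OF \<alpha> J_posdef] unfolding f_def by blast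
  have fc: "continuous_on UNIV f" unfolding f_def by (rule continuous_on_f_fun)
  have ht: "has_hom_type f \<mu> (kk \<mu>)" if \<mu>: "\<mu> \<in> S" for \<mu>
  proof -
    obtain k where k: "has_hom_type f \<mu> k"
      using all_types \<mu> unfolding S_def f_def by blast
    then show ?thesis by (simp add: kk_def hom_type_eq[OF k])
  qed
  have k1: "1 \<le> kk \<mu>" if "\<mu> \<in> S" for \<mu>
    using ht[OF that] by (simp add: has_hom_type_def)
  have lim: "\<And>y. ((\<lambda>t. (f (\<mu> + t *\<^sub>R y) - f \<mu>) / t ^ (2 * kk \<mu>)) \<longlongrightarrow> T \<mu> y) (at_right 0)"
    and bnd: "\<exists>r>0. \<exists>c>0. \<forall>y. norm y \<le> r \<longrightarrow> f (\<mu> + y) - f \<mu> \<le> - c * norm y ^ (2 * kk \<mu>)" if "\<mu> \<in> S" for \<mu>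
    unfolding T_def f_def
    by (rule f_fun_expansion[OF J_sym ht[OF that, unfolded f_def]])+
  have Seq: "S = {\<mu>. \<forall>x. f x \<le> f \<mu>}" by (simp add: S_def global_max_points_def)
  obtain z where z: "z \<in> S" using coercive_attains_global_max(1)[OF fc a] by (auto simp: Seq)
  \<comment> \<open>The Laplace results are stated for maximum value 0; the factor
    \<open>exp (Ns i * f z)\<close> removed here cancels in the ratio of integrals.\<close>
  define F where "F = (\<lambda>x. f x - f z)"
  have Sval: "f \<mu> = f z" if "\<mu> \<in> S" for \<mu> using that z by (auto simp: Seq intro: antisym)
  have F: "continuous_on UNIV F" "\<And>x. F x \<le> 0" "S = {x. F x = 0}" "\<And>x. F x \<le> (C - f z) - a * (norm x)\<^sup>2"
  proof -
    show "continuous_on UNIV F" unfolding F_def by (intro continuous_intros fc)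
    show "F x \<le> 0" for x using z by (simp add: F_def Seq)
    show "S = {x. F x = 0}"
    proof (intro set_eqI iffI)
      fix x assume "x \<in> {x. F x = 0}"
      then have "f x = f z" by (simp add: F_def)
      then show "x \<in> S" using z by (simp add: Seq)
    qed (simp add: F_def Sval)
    show "F x \<le> (C - f z) - a * (norm x)\<^sup>2" for x using a(2)[of x] by (simp add: F_def)
  qed
  have finS: "finite S"
    unfolding Seq
  proof (rule finite_global_max[OF fc a])
    fix \<mu> assume "\<forall>x. f x \<le> f \<mu>"
    then have "\<mu> \<in> S" by (simp add: Seq)
    from bnd[OF this] obtain r c where r: "r > 0" and c: "c > 0"
      and le: "\<forall>y. norm y \<le> r \<longrightarrow> f (\<mu> + y) - f \<mu> \<le> - c * norm y ^ (2 * kk \<mu>)"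
      by (elim exE conjE)
    have "f (\<mu> + y) < f \<mu>" if "y \<noteq> 0" "norm y \<le> r" for y
    proof -
      have "c * norm y ^ (2 * kk \<mu>) > 0" using c that(1) by simp
      then show ?thesis using le that(2) by fastforce
    qed
    then show "\<exists>r>0. \<forall>y. y \<noteq> 0 \<longrightarrow> norm y \<le> r \<longrightarrow> f (\<mu> + y) < f \<mu>" using r by blast
  qed
  \<comment> \<open>Finiteness of \<open>S\<close> and the existence of \<open>z\<close> make this
    \<open>Max\<close> an attained maximum, so that \<open>S'\<close> is nonempty.\<close>
  have K: "K = Max (kk ` S)" by (simp add: K_def max_hom_type_def kk_def S_def)
  have kK: "kk \<mu> \<le> K" if "\<mu> \<in> S" for \<mu> unfolding K using finS that by simp
  have "K \<in> kk ` S" unfolding K using finS z by (intro Max_in) auto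
  then have S'ne: "S' \<noteq> {}" unfolding S'_def by blast
  have S'fin: "finite S'" using finS by (simp add: S'_def)
  have Flim: "\<And>y. ((\<lambda>t. F (\<mu> + t *\<^sub>R y) / t ^ (2 * kk \<mu>)) \<longlongrightarrow> T \<mu> y) (at_right 0)"
    and Fbnd: "\<exists>r>0. \<exists>c>0. \<forall>y. norm y \<le> r \<longrightarrow> F (\<mu> + y) \<le> - c * norm y ^ (2 * kk \<mu>)" if "\<mu> \<in> S" for \<mu>
    using lim[OF that] bnd[OF that] by (simp_all add: F_def Sval[OF that])
  have intT: "integrable lborel (\<lambda>y. exp (T \<mu> y))" if "\<mu> \<in> S" for \<mu>
  proof -
    from Fbnd[OF that] obtain r c where rc: "r > 0" "c > 0"
      and le: "\<forall>y. norm y \<le> r \<longrightarrow> F (\<mu> + y) \<le> - c * norm y ^ (2 * kk \<mu>)"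
      by (elim exE conjE)
    \<comment> \<open>Only the integrability claim of the local result is of interest here, so any
      positive null sequence serves as scale.\<close>
    show ?thesis
      by (rule laplace_local(2)[OF borel_measurable_continuous_onI[OF F(1)] _ _ k1[OF that] rc le[rule_format] Flim[OF that],
            where \<phi>="\<lambda>_. 1" and B=1 and s="\<lambda>i. inverse (real (Suc i))"])
         (auto intro: LIMSEQ_inverse_real_of_nat simp del: of_nat_Suc)
  qed
  define c where "c = (\<lambda>\<mu>. \<integral>y. exp (T \<mu> y) \<partial>lborel)"
  have c: "c \<mu> > 0" if "\<mu> \<in> S" for \<mu> unfolding c_def by (rule integral_exp_pos[OF intT[OF that]])
  \<comment> \<open>The Jacobian of the coordinate scaling in \<open>b_weight\<close> at order
    \<open>K\<close>; it multiplies all weights alike and leaves the mixture unchanged.\<close>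
  define Q where "Q = (\<Prod>l\<in>UNIV. \<alpha> l powr (1 / real (2*K)))"
  have Q: "Q > 0" unfolding Q_def using \<alpha> by (intro prod_pos) (auto simp: less_imp_neq[symmetric])
  have b: "b_weight \<alpha> f K \<mu> = Q * c \<mu>" if "\<mu> \<in> S'" for \<mu>
    using b_weight_eq[OF \<alpha>, of f \<mu> K] intT[of \<mu>] that by (simp add: S'_def T_def Q_def c_def)
  have csum: "(\<Sum>\<mu>\<in>S'. c \<mu>) > 0" using S'fin S'ne c by (intro sum_pos) (auto simp: S'_def)
  have S'eq: "{\<mu>\<in>global_max_points f. has_hom_type f \<mu> K} = S'"
  proof -
    have "has_hom_type f \<mu> K \<longleftrightarrow> kk \<mu> = K" if "\<mu> \<in> S" for \<mu>
      using ht[OF that] hom_type_eq[of f \<mu> K] by (auto simp: kk_def)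
    then show ?thesis unfolding S'_def S_def[symmetric] by blast
  qed
  have limit_expectation: "measure_pmf.expectation (weighted_dirac_mixture S' (b_weight \<alpha> f K)) \<phi>
      = (\<Sum>\<mu>\<in>S'. \<phi> \<mu> * c \<mu>) / (\<Sum>\<mu>\<in>S'. c \<mu>)" for \<phi> :: "real^'n \<Rightarrow> real"
  proof -
    have bs: "(\<Sum>\<mu>\<in>S'. b_weight \<alpha> f K \<mu>) = Q * (\<Sum>\<mu>\<in>S'. c \<mu>)"
      by (simp add: b sum_distrib_left)
    have "measure_pmf.expectation (weighted_dirac_mixture S' (b_weight \<alpha> f K)) \<phi>
        = (\<Sum>\<mu>\<in>S'. \<phi> \<mu> * b_weight \<alpha> f K \<mu>) / (\<Sum>\<mu>\<in>S'. b_weight \<alpha> f K \<mu>)"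
      unfolding weighted_dirac_mixture_def
    proof (rule expectation_embed_pmf_finite[OF S'fin])
      show "0 \<le> b_weight \<alpha> f K \<mu>" if "\<mu> \<in> S'" for \<mu>
        using b[OF that] Q c[of \<mu>] that by (simp add: S'_def)
      show "0 < (\<Sum>\<mu>\<in>S'. b_weight \<alpha> f K \<mu>)" unfolding bs using Q csum by simp
    qed
    also have "(\<Sum>\<mu>\<in>S'. \<phi> \<mu> * b_weight \<alpha> f K \<mu>) = Q * (\<Sum>\<mu>\<in>S'. \<phi> \<mu> * c \<mu>)"
      by (simp add: b sum_distrib_left mult_ac)
    finally show ?thesis using Q by (simp add: bs)
  qed
  have main: "(\<lambda>i. measure_pmf.expectation (magnetization_law \<alpha> J h (Ns i) (Ps i)) \<phi>)
      \<longlonglongrightarrow> (\<Sum>\<mu>\<in>S'. \<phi> \<mu> * c \<mu>) / (\<Sum>\<mu>\<in>S'. c \<mu>)"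
    if Ns: "filterlim Ns at_top sequentially" "\<And>i. Ns i \<ge> 1" and P: "\<And>i. is_block_partition \<alpha> (Ns i) (Ps i)"
      and \<phi>: "continuous_on UNIV \<phi>" "\<And>x. \<bar>\<phi> x\<bar> \<le> B" for Ns Ps B and \<phi> :: "real^'n \<Rightarrow> real"
  proof -
    define I where "I = (\<lambda>\<phi> i. real (Ns i) powr (DIM(real^'n) / (2 * real K)) * (\<integral>x. \<phi> x * exp (Ns i * F x) \<partial>lborel))"
    have I: "I \<psi> \<longlonglongrightarrow> (\<Sum>\<mu>\<in>S'. \<psi> \<mu> * c \<mu>)" if "continuous_on UNIV \<psi>" "\<And>x. \<bar>\<psi> x\<bar> \<le> B'" for \<psi> B'
      unfolding I_def S'_def c_def
      by (rule laplace_global[OF F(1,2) that F(3) finS k1 kK Fbnd Flim a(1) F(4) Ns])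
    have ratio: "(\<integral>x. \<phi> x * exp (Ns i * f x) \<partial>lborel) / (\<integral>x. exp (Ns i * f x) \<partial>lborel) = I \<phi> i / I (\<lambda>_. 1) i" for i
    proof -
      have e1: "(\<lambda>x. exp (Ns i * f x)) = (\<lambda>x. exp (Ns i * f z) * exp (Ns i * F x))"
        by (simp add: F_def exp_add[symmetric] algebra_simps)
      have e2: "(\<lambda>x. \<phi> x * exp (Ns i * f x)) = (\<lambda>x. exp (Ns i * f z) * (\<phi> x * exp (Ns i * F x)))"
      proof
        show "\<phi> x * exp (Ns i * f x) = exp (Ns i * f z) * (\<phi> x * exp (Ns i * F x))" for x
          using fun_cong[OF e1, of x] by simp
      qed
      have "real (Ns i) powr (DIM(real^'n) / (2 * real K)) > 0" using Ns(2)[of i] by simp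
      moreover have "(\<integral>x. \<phi> x * exp (Ns i * f x) \<partial>lborel) = exp (Ns i * f z) * (\<integral>x. \<phi> x * exp (Ns i * F x) \<partial>lborel)"
        unfolding e2 by simp
      moreover have "(\<integral>x. exp (Ns i * f x) \<partial>lborel) = exp (Ns i * f z) * (\<integral>x. exp (Ns i * F x) \<partial>lborel)"
        unfolding e1 by simp
      ultimately show ?thesis by (simp add: I_def)
    qed
    have "(\<lambda>i. I \<phi> i / I (\<lambda>_. 1) i) \<longlonglongrightarrow> (\<Sum>\<mu>\<in>S'. \<phi> \<mu> * c \<mu>) / (\<Sum>\<mu>\<in>S'. 1 * c \<mu>)"
      using csum by (intro tendsto_divide I[OF \<phi>] I[of "\<lambda>_. 1" 1]) auto
    then have "(\<lambda>i. (\<integral>x. \<phi> x * exp (Ns i * f x) \<partial>lborel) / (\<integral>x. exp (Ns i * f x) \<partial>lborel))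
        \<longlonglongrightarrow> (\<Sum>\<mu>\<in>S'. \<phi> \<mu> * c \<mu>) / (\<Sum>\<mu>\<in>S'. c \<mu>)"
      by (simp add: ratio)
    from tendsto_diff[OF this expectation_minus_smoothed_tendsto_0[OF \<alpha> J_sym J_posdef \<phi> Ns P, of h, folded f_def]]
    show ?thesis by simp
  qed
  show ?thesis
    unfolding f_def[symmetric] K_def[symmetric] S'eq weak_conv_pmf_def
  proof (intro allI impI, elim conjE)
    fix Ns :: "nat \<Rightarrow> nat" and Ps :: "nat \<Rightarrow> 'n \<Rightarrow> nat set" and \<phi> :: "real^'n \<Rightarrow> real"
    assume Ns: "filterlim Ns at_top sequentially" and P: "\<forall>i. is_block_partition \<alpha> (Ns i) (Ps i)"
      and \<phi>: "continuous_on UNIV \<phi>" "bounded (range \<phi>)"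
    obtain B where B: "\<And>x. \<bar>\<phi> x\<bar> \<le> B" using \<phi>(2) by (auto simp: bounded_iff)
    \<comment> \<open>Finitely many sizes may be 0, where the formulas with
      \<open>1 / sqrt N\<close> break down; an initial segment is dropped, which does not affect the
      limit.\<close>
    have "\<forall>\<^sub>F i in sequentially. Ns i \<ge> 1" using Ns by (simp add: filterlim_at_top)
    then obtain i0 where i0: "\<And>i. i \<ge> i0 \<Longrightarrow> Ns i \<ge> 1" by (auto simp: eventually_sequentially)
    have "(\<lambda>i. measure_pmf.expectation (magnetization_law \<alpha> J h (Ns (i + i0)) (Ps (i + i0))) \<phi>)
      \<longlonglongrightarrow> (\<Sum>\<mu>\<in>S'. \<phi> \<mu> * c \<mu>) / (\<Sum>\<mu>\<in>S'. c \<mu>)"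
      using P i0 \<phi>(1) B
      by (intro main[where B=B] filterlim_compose[OF Ns] filterlim_add_const_nat_at_top) auto
    then have "(\<lambda>i. measure_pmf.expectation (magnetization_law \<alpha> J h (Ns i) (Ps i)) \<phi>)
      \<longlonglongrightarrow> (\<Sum>\<mu>\<in>S'. \<phi> \<mu> * c \<mu>) / (\<Sum>\<mu>\<in>S'. c \<mu>)"
      by (rule LIMSEQ_offset)
    then show "(\<lambda>i. measure_pmf.expectation (magnetization_law \<alpha> J h (Ns i) (Ps i)) \<phi>)
      \<longlonglongrightarrow> measure_pmf.expectation (weighted_dirac_mixture S' (b_weight \<alpha> f K)) \<phi>"
      by (simp add: limit_expectation)
  qed
qed

end
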